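(* Let $G$ be a locally compact, compactly generated, amenable group. Let $f$ be a uniform map of $G$ into a Hilbert space, with compression $\rho$ and dilation $\delta$. Then there is a constant $a\ge0$ such that $G$ admits a 1-cocycle with compression $\ge\rho-a$ and dilation $\le\delta+a$. If $G$ is discrete, one can take $a=0$.
   Context: Let $|\cdot|_S$ be the word length on $G$ with respect to a compact symmetric generating subset $S$. For an arbitrary map $f:G\to\mathcal{H}$ (not necessarily continuous) to a Hilbert space, its dilation is $\delta(x)=\sup\{\|f(g)-f(h)\|:|g^{-1}h|_S\le x\}\in\mathbf{R}_+\cup\{\infty\}$ and its compression is $\rho(x)=\inf\{\|f(g)-f(h)\|:|g^{-1}h|_S\ge x\}\in\mathbf{R}_+\cup\{\infty\}$, for $x\in\mathbf{R}_+$. The map $f$ is a uniform map if $\delta(x)<\infty$ for all $x\in\mathbf{R}_+$. A 1-cocycle of $G$ is a continuous map $b:G\to\mathcal{H}$ to a Hilbert space carrying a continuous unitary or orthogonal representation $\pi$ of $G$, with $b(gh)=\pi(g)b(h)+b(g)$ for all $g,h\in G$. Its compression and dilation are those of $b$ as a map; since $\|b(g)-b(h)\|=\|b(g^{-1}h)\|$, they are $x\mapsto\inf\{\|b(g)\|:|g|_S\ge x\}$ and $x\mapsto\sup\{\|b(g)\|:|g|_S\le x\}$. *)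

theory Defs
  imports "HOL-Analysis.Analysis"
begin

text \<open>
  Groups are written additively, because the library's type class of topological groups is
  \<^class>\<open>topological_group_add\<close>. That class does not assume commutativity: \<open>g + h\<close> stands
  for the product $gh$, \<open>- g + h\<close> for $g^{-1}h$ and \<open>0\<close> for the identity. Hilbert spaces are
  real, i.e. types of class \<^class>\<open>real_inner\<close> and \<^class>\<open>complete_space\<close>. A complex Hilbert
  space is one of these after restriction of scalars, which changes neither norms nor the
  continuity of maps, and turns unitary representations into orthogonal ones.
\<close>

section \<open>Word length, dilation and compression\<close>

definition symmetric_set :: "'g::group_add set \<Rightarrow> bool" where
  "symmetric_set S \<longleftrightarrow> uminus ` S = S"

definition generates_group :: "'g::group_add set \<Rightarrow> bool" where
  "generates_group S \<longleftrightarrow> (\<forall>g. \<exists>w. set w \<subseteq> S \<union> uminus ` S \<and> sum_list w = g)"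

definition word_length :: "'g::group_add set \<Rightarrow> 'g \<Rightarrow> nat" where
  "word_length S g = (LEAST n. \<exists>w. length w = n \<and> set w \<subseteq> S \<union> uminus ` S \<and> sum_list w = g)"

text \<open>
  For \<open>x \<ge> 0\<close> the supremum below is over a nonempty set. The infimum may be over the empty
  set (when the word length is bounded), and is then \<open>\<infinity>\<close>.
\<close>

definition dilation ::
    "'g::group_add set \<Rightarrow> ('g \<Rightarrow> 'h::real_normed_vector) \<Rightarrow> real \<Rightarrow> ereal" where
  "dilation S f x =
     Sup {ereal (norm (f g - f h)) | g h. real (word_length S (- g + h)) \<le> x}"

definition compression ::
    "'g::group_add set \<Rightarrow> ('g \<Rightarrow> 'h::real_normed_vector) \<Rightarrow> real \<Rightarrow> ereal" where
  "compression S f x =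
     Inf {ereal (norm (f g - f h)) | g h. real (word_length S (- g + h)) \<ge> x}"

definition uniform_map ::
    "'g::group_add set \<Rightarrow> ('g \<Rightarrow> 'h::real_normed_vector) \<Rightarrow> bool" where
  "uniform_map S f \<longleftrightarrow> (\<forall>x\<ge>0. dilation S f x < \<infinity>)"


section \<open>Amenability\<close>

definition left_translate ::
    "'g::topological_group_add \<Rightarrow> ('g \<Rightarrow>\<^sub>C real) \<Rightarrow> ('g \<Rightarrow>\<^sub>C real)" where
  "left_translate g \<phi> = Bcontfun (\<lambda>x. apply_bcontfun \<phi> (- g + x))"

lemma left_translate_apply [simp]:
  "apply_bcontfun (left_translate g \<phi>) x = apply_bcontfun \<phi> (- g + x)"
proof -
  have "continuous_on UNIV (\<lambda>x. apply_bcontfun \<phi> (- g + x))"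
    by (rule continuous_on_compose2[OF continuous_on_apply_bcontfun[where T = UNIV]])
      (auto intro!: continuous_intros)
  moreover have "bounded (range (\<lambda>x. apply_bcontfun \<phi> (- g + x)))"
    using apply_bcontfun[of \<phi>] by (auto simp: bcontfun_def intro: bounded_subset)
  ultimately show ?thesis
    unfolding left_translate_def by (subst Bcontfun_inverse) (auto simp: bcontfun_def)
qed

text \<open>
  A locally compact group is amenable if there is a left-invariant mean on its bounded
  continuous functions. For locally compact groups this agrees with the definition by
  invariant means on $L^\infty(G)$, and it does not refer to Haar measure.
\<close>

definition left_invariant_mean :: "(('g::topological_group_add \<Rightarrow>\<^sub>C real) \<Rightarrow> real) \<Rightarrow> bool" where
  "left_invariant_mean m \<longleftrightarrow>
     linear m \<and>
     (\<forall>\<phi>. (\<forall>x. 0 \<le> apply_bcontfun \<phi> x) \<longrightarrow> 0 \<le> m \<phi>) \<and>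
     m (const_bcontfun 1) = 1 \<and>
     (\<forall>g \<phi>. m (left_translate g \<phi>) = m \<phi>)"

definition amenable :: "'g::topological_group_add itself \<Rightarrow> bool" where
  "amenable _ \<longleftrightarrow> (\<exists>m :: ('g \<Rightarrow>\<^sub>C real) \<Rightarrow> real. left_invariant_mean m)"


section \<open>Orthogonal representations and 1-cocycles\<close>

text \<open>
  Each \<open>\<pi> g\<close> is a surjective isometry because it has the inverse \<open>\<pi> (- g)\<close>. Continuity of the
  representation is continuity for the strong operator topology.
\<close>

definition orthogonal_representation ::
    "('g::topological_group_add \<Rightarrow> 'h::real_inner \<Rightarrow> 'h) \<Rightarrow> bool" where
  "orthogonal_representation \<pi> \<longleftrightarrow>
     (\<forall>g. orthogonal_transformation (\<pi> g)) \<and>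
     \<pi> 0 = id \<and>
     (\<forall>g h. \<pi> (g + h) = \<pi> g \<circ> \<pi> h) \<and>
     (\<forall>v. continuous_on UNIV (\<lambda>g. \<pi> g v))"

definition one_cocycle ::
    "('g::topological_group_add \<Rightarrow> 'h::real_inner \<Rightarrow> 'h) \<Rightarrow> ('g \<Rightarrow> 'h) \<Rightarrow> bool" where
  "one_cocycle \<pi> b \<longleftrightarrow>
     orthogonal_representation \<pi> \<and>
     continuous_on UNIV b \<and>
     (\<forall>g h. b (g + h) = \<pi> g (b h) + b g)"


section \<open>The Hilbert space of square-summable families\<close>

text \<open>
  The existence of a 1-cocycle of a group of type \<open>'g\<close> in some Hilbert space is expressed with
  the Hilbert space \<open>'g ell2\<close>, since one cannot quantify existentially over types. This loses
  no generality. Let \<open>b\<close> be a 1-cocycle of \<open>\<pi>\<close> in an arbitrary Hilbert space. By the cocycle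
  identity the closed linear span of the range of \<open>b\<close> is \<open>\<pi>\<close>-invariant, and its Hilbert
  dimension is at most the cardinality of \<open>'g\<close>. So it embeds isometrically into
  \<open>'g ell2\<close>; extending \<open>\<pi>\<close> by the identity on the orthogonal complement of the image gives a
  1-cocycle in \<open>'g ell2\<close> with the same norms.
\<close>

typedef 'i ell2 = "{x :: 'i \<Rightarrow> real. (\<lambda>i. (x i)\<^sup>2) summable_on UNIV}"
  morphisms ell2_nth Abs_ell2
  by (rule exI[of _ "\<lambda>_. 0"]) simp

setup_lifting type_definition_ell2

lemma ell2_nth_summable: "(\<lambda>i. (ell2_nth x i)\<^sup>2) summable_on UNIV"
  using ell2_nth[of x] by simp

lemma ell2_eqI: "(\<And>i. ell2_nth x i = ell2_nth y i) \<Longrightarrow> x = y"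
  by (simp add: ell2_nth_inject[symmetric] fun_eq_iff)

lemma ell2_add_summable:
  fixes x y :: "'i \<Rightarrow> real"
  assumes "(\<lambda>i. (x i)\<^sup>2) summable_on UNIV" "(\<lambda>i. (y i)\<^sup>2) summable_on UNIV"
  shows "(\<lambda>i. (x i + y i)\<^sup>2) summable_on UNIV"
proof (rule summable_on_comparison_test)
  show "(\<lambda>i. 2 * (x i)\<^sup>2 + 2 * (y i)\<^sup>2) summable_on UNIV"
    using assms by (intro summable_on_add summable_on_cmult_right)
  show "(x i + y i)\<^sup>2 \<le> 2 * (x i)\<^sup>2 + 2 * (y i)\<^sup>2" for i
    using zero_le_power2[of "x i - y i"] by (simp add: power2_eq_square algebra_simps)
qed auto

lemma ell2_scale_summable:
  fixes x :: "'i \<Rightarrow> real"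
  assumes "(\<lambda>i. (x i)\<^sup>2) summable_on UNIV"
  shows "(\<lambda>i. (c * x i)\<^sup>2) summable_on UNIV"
  using summable_on_cmult_right[OF assms, of "c\<^sup>2"] by (simp add: power_mult_distrib)

lemma ell2_prod_summable:
  fixes x y :: "'i \<Rightarrow> real"
  assumes x: "(\<lambda>i. (x i)\<^sup>2) summable_on UNIV" and y: "(\<lambda>i. (y i)\<^sup>2) summable_on UNIV"
  shows "(\<lambda>i. x i * y i) summable_on UNIV"
proof -
  have "(\<lambda>i. (1/2) * ((x i + y i)\<^sup>2 + (- 1) * ((x i)\<^sup>2 + (y i)\<^sup>2))) summable_on UNIV"
    by (intro summable_on_cmult_right summable_on_add ell2_add_summable x y)
  then show ?thesis
    by (simp add: power2_eq_square algebra_simps)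
qed

instantiation ell2 :: (type) real_vector
begin

lift_definition zero_ell2 :: "'a ell2" is "\<lambda>_. 0"
  by simp

lift_definition plus_ell2 :: "'a ell2 \<Rightarrow> 'a ell2 \<Rightarrow> 'a ell2" is "\<lambda>x y i. x i + y i"
  by (rule ell2_add_summable)

lift_definition uminus_ell2 :: "'a ell2 \<Rightarrow> 'a ell2" is "\<lambda>x i. - x i"
  by simp

definition minus_ell2 :: "'a ell2 \<Rightarrow> 'a ell2 \<Rightarrow> 'a ell2" where
  "minus_ell2 x y = x + - y"

lift_definition scaleR_ell2 :: "real \<Rightarrow> 'a ell2 \<Rightarrow> 'a ell2" is "\<lambda>c x i. c * x i"
  by (rule ell2_scale_summable)

lemma ell2_nth_simps [simp]:
  "ell2_nth 0 i = 0"
  "ell2_nth (x + y) i = ell2_nth x i + ell2_nth y i"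
  "ell2_nth (- x) i = - ell2_nth x i"
  "ell2_nth (x - y) i = ell2_nth x i - ell2_nth y i"
  "ell2_nth (c *\<^sub>R x) i = c * ell2_nth x i"
  by (simp_all add: zero_ell2.rep_eq plus_ell2.rep_eq uminus_ell2.rep_eq
      minus_ell2_def scaleR_ell2.rep_eq)

instance
  by standard (rule ell2_eqI, simp add: algebra_simps)+

end

instantiation ell2 :: (type) real_inner
begin

definition inner_ell2 :: "'a ell2 \<Rightarrow> 'a ell2 \<Rightarrow> real" where
  "inner_ell2 x y = (\<Sum>\<^sub>\<infinity>i. ell2_nth x i * ell2_nth y i)"

definition norm_ell2 :: "'a ell2 \<Rightarrow> real" where
  "norm_ell2 x = sqrt (x \<bullet> x)"

definition sgn_ell2 :: "'a ell2 \<Rightarrow> 'a ell2" where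
  "sgn_ell2 x = x /\<^sub>R norm x"

definition dist_ell2 :: "'a ell2 \<Rightarrow> 'a ell2 \<Rightarrow> real" where
  "dist_ell2 x y = norm (x - y)"

definition uniformity_ell2 :: "('a ell2 \<times> 'a ell2) filter" where
  "uniformity_ell2 = (INF e\<in>{0<..}. principal {(x, y). dist x y < e})"

definition open_ell2 :: "'a ell2 set \<Rightarrow> bool" where
  "open_ell2 U \<longleftrightarrow> (\<forall>x\<in>U. eventually (\<lambda>(x', y). x' = x \<longrightarrow> y \<in> U) uniformity)"

instance
proof
  fix x y z :: "'a ell2" and c :: real
  note prod = ell2_prod_summable[OF ell2_nth_summable ell2_nth_summable]
  show "dist x y = norm (x - y)" by (rule dist_ell2_def)
  show "sgn x = x /\<^sub>R norm x" by (rule sgn_ell2_def)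
  show "(uniformity :: ('a ell2 \<times> 'a ell2) filter)
      = (INF e\<in>{0<..}. principal {(x, y). dist x y < e})" by (rule uniformity_ell2_def)
  show "open U \<longleftrightarrow> (\<forall>x\<in>U. eventually (\<lambda>(x', y). x' = x \<longrightarrow> y \<in> U) uniformity)"
    for U :: "'a ell2 set" by (rule open_ell2_def)
  show "x \<bullet> y = y \<bullet> x" by (simp add: inner_ell2_def mult.commute)
  show "(x + y) \<bullet> z = x \<bullet> z + y \<bullet> z"
    by (simp add: inner_ell2_def distrib_right infsum_add prod)
  show "(c *\<^sub>R x) \<bullet> y = c * (x \<bullet> y)"
    by (simp add: inner_ell2_def mult.assoc infsum_cmult_right')
  show "0 \<le> x \<bullet> x" by (simp add: inner_ell2_def infsum_nonneg)
  show "x \<bullet> x = 0 \<longleftrightarrow> x = 0"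
  proof
    assume *: "x \<bullet> x = 0"
    show "x = 0"
    proof (rule ell2_eqI)
      fix i
      have "ell2_nth x i * ell2_nth x i = 0"
        using * by (intro nonneg_infsum_le_0D[where A = UNIV]) (auto simp: inner_ell2_def prod)
      then show "ell2_nth x i = ell2_nth 0 i" by simp
    qed
  qed (simp add: inner_ell2_def)
  show "norm x = sqrt (x \<bullet> x)" by (rule norm_ell2_def)
qed

end

lemma ell2_norm_square: "(norm x)\<^sup>2 = (\<Sum>\<^sub>\<infinity>i. (ell2_nth x i)\<^sup>2)"
  unfolding power2_norm_eq_inner inner_ell2_def by (simp only: power2_eq_square)

lemma ell2_finite_sum_le: "finite F \<Longrightarrow> (\<Sum>i\<in>F. (ell2_nth x i)\<^sup>2) \<le> (norm x)\<^sup>2"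
  unfolding ell2_norm_square by (rule finite_sum_le_infsum[OF ell2_nth_summable]) auto

lemma ell2_norm_leI:
  assumes "\<And>F. finite F \<Longrightarrow> (\<Sum>i\<in>F. (ell2_nth x i)\<^sup>2) \<le> e\<^sup>2" "0 \<le> e"
  shows "norm x \<le> e"
proof -
  have "(\<Sum>\<^sub>\<infinity>i. (ell2_nth x i)\<^sup>2) \<le> e\<^sup>2"
    by (rule infsum_le_finite_sums[OF ell2_nth_summable]) (use assms in auto)
  then have "(norm x)\<^sup>2 \<le> e\<^sup>2"
    by (simp only: ell2_norm_square)
  then show ?thesis using assms(2) by (rule power2_le_imp_le)
qed

lemma ell2_nth_le_norm: "\<bar>ell2_nth x i\<bar> \<le> norm x"
  using ell2_finite_sum_le[of "{i}" x] by (simp add: power2_le_iff_abs_le)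

instance ell2 :: (type) complete_space
proof
  fix X :: "nat \<Rightarrow> 'a ell2"
  assume X: "Cauchy X"
  have "Cauchy (\<lambda>n. ell2_nth (X n) i)" for i
  proof (rule metric_CauchyI)
    fix e :: real assume "e > 0"
    then obtain N where N: "\<forall>m\<ge>N. \<forall>n\<ge>N. dist (X m) (X n) < e"
      using metric_CauchyD[OF X] by blast
    have "dist (ell2_nth (X m) i) (ell2_nth (X n) i) \<le> dist (X m) (X n)" for m n
      using ell2_nth_le_norm[of "X m - X n" i] by (simp add: dist_norm)
    with N show "\<exists>N. \<forall>m\<ge>N. \<forall>n\<ge>N. dist (ell2_nth (X m) i) (ell2_nth (X n) i) < e"
      by (meson le_less_trans)
  qed
  then have "\<exists>l. (\<lambda>n. ell2_nth (X n) i) \<longlonglongrightarrow> l" for i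
    using Cauchy_convergent convergent_def by blast
  then obtain l where l: "\<And>i. (\<lambda>n. ell2_nth (X n) i) \<longlonglongrightarrow> l i"
    by metis
  have tail: "\<exists>N. \<forall>n\<ge>N. \<forall>F. finite F \<longrightarrow> (\<Sum>i\<in>F. (ell2_nth (X n) i - l i)\<^sup>2) \<le> e\<^sup>2"
    if e: "e > 0" for e
  proof -
    obtain N where N: "\<forall>m\<ge>N. \<forall>n\<ge>N. dist (X m) (X n) < e"
      using metric_CauchyD[OF X e] by blast
    have "(\<Sum>i\<in>F. (ell2_nth (X n) i - l i)\<^sup>2) \<le> e\<^sup>2" if "n \<ge> N" "finite F" for n F
    proof (rule tendsto_upperbound)
      show "(\<lambda>m. \<Sum>i\<in>F. (ell2_nth (X n) i - ell2_nth (X m) i)\<^sup>2)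
          \<longlonglongrightarrow> (\<Sum>i\<in>F. (ell2_nth (X n) i - l i)\<^sup>2)"
        by (intro tendsto_intros l)
      have "(\<Sum>i\<in>F. (ell2_nth (X n) i - ell2_nth (X m) i)\<^sup>2) \<le> e\<^sup>2" if "m \<ge> N" for m
      proof -
        have "(\<Sum>i\<in>F. (ell2_nth (X n) i - ell2_nth (X m) i)\<^sup>2) \<le> (norm (X n - X m))\<^sup>2"
          using ell2_finite_sum_le[OF \<open>finite F\<close>, of "X n - X m"] by simp
        also have "\<dots> \<le> e\<^sup>2"
          using N \<open>n \<ge> N\<close> that by (intro power_mono) (auto simp: dist_norm less_imp_le)
        finally show ?thesis .
      qed
      then show "\<forall>\<^sub>F m in sequentially. (\<Sum>i\<in>F. (ell2_nth (X n) i - ell2_nth (X m) i)\<^sup>2) \<le> e\<^sup>2"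
        using eventually_at_top_linorder by blast
    qed simp
    then show ?thesis by blast
  qed
  obtain N where N: "\<forall>n\<ge>N. \<forall>F. finite F \<longrightarrow> (\<Sum>i\<in>F. (ell2_nth (X n) i - l i)\<^sup>2) \<le> 1\<^sup>2"
    using tail[of 1] by auto
  have "(\<lambda>i. (ell2_nth (X N) i - l i)\<^sup>2) summable_on UNIV"
    using N by (intro nonneg_bdd_above_summable_on) (auto intro!: bdd_aboveI[where M = 1])
  from ell2_add_summable[OF ell2_nth_summable[of "X N"] ell2_scale_summable[OF this, of "- 1"]]
  have "(\<lambda>i. (l i)\<^sup>2) summable_on UNIV" by simp
  then have L: "ell2_nth (Abs_ell2 l) = l"
    by (simp add: Abs_ell2_inverse)
  have "X \<longlonglongrightarrow> Abs_ell2 l"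
  proof (rule metric_LIMSEQ_I)
    fix e :: real assume "e > 0"
    then obtain N where N: "\<forall>n\<ge>N. \<forall>F. finite F \<longrightarrow> (\<Sum>i\<in>F. (ell2_nth (X n) i - l i)\<^sup>2) \<le> (e/2)\<^sup>2"
      using tail[of "e/2"] by auto
    have "norm (X n - Abs_ell2 l) \<le> e/2" if "n \<ge> N" for n
      using N that \<open>e > 0\<close> by (intro ell2_norm_leI) (auto simp: L)
    with \<open>e > 0\<close> show "\<exists>N. \<forall>n\<ge>N. dist (X n) (Abs_ell2 l) < e"
      by (intro exI[of _ N]) (force simp: dist_norm)
  qed
  then show "convergent X" by (rule convergentI)
qed

end

theory Submission
  imports Defs
begin

text \<open>
  Suppose first that \<open>f\<close> is uniformly continuous. For every \<open>x\<close>, the map $g \mapsto f(x^{-1}g) - f(x^{-1})$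
  has the same increments as a translate of \<open>f\<close>, and so it satisfies the same bounds as \<open>f\<close> in terms of
  the word length. Averaging the Gram matrices of these maps over \<open>x\<close> with an invariant mean gives a
  positive semidefinite kernel $K(g,h)$ on the group that is invariant in the sense that
  $K(gh,gk) - K(gh,g) - K(g,gk) + K(g,g) = K(h,k)$ (\<open>cocycle_of_amenable_average\<close>). A family of
  vectors $b(g)$ with this Gram matrix exists in the Hilbert space over the group by transfinite
  Gram-Schmidt (\<open>psd_kernel_Gram\<close>). Invariance says exactly that $b(h) \mapsto b(gh) - b(g)$ is
  isometric, which produces the orthogonal representation for which \<open>b\<close> is a cocycle
  (\<open>cocycle_of_invariant_increments\<close>). Since $\|b(g)\|^2$ is the mean of the squared increments of \<open>f\<close>
  over pairs at word distance $|g|$, the bounds by compression and dilation carry over without loss.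

  A general uniform map is within bounded distance \<open>c\<close> of a uniformly continuous one
  (\<open>uniform_map_smoothing\<close>), at the price \<open>a = 2 * c\<close>. Being bounded on word balls controls \<open>f\<close> near
  a point because some word ball is a neighbourhood of the identity, by Baire's theorem
  (\<open>word_ball_neighbourhood\<close>). On a discrete group every map is uniformly continuous, so \<open>c = 0\<close>.
\<close>

section \<open>Functionals with prescribed values\<close>

text \<open>
  The Riesz representation theorem for a functional given by its graph \<open>Q\<close>. That \<open>s\<close> is determined
  by \<open>u\<close> is contained in the bound, so a functional can be prescribed on a linearly dependent
  spanning family: \<open>Q\<close> is then the span of the pairs (vector, value). The representing vector is
  the limit of a minimizing sequence for $\|u\|^2 - 2s$ on \<open>Q\<close>, which is a Cauchy sequence by the
  parallelogram law; its defining equation is the vanishing of the first variation.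
\<close>

lemma Riesz_graph:
  fixes Q :: "('h::{real_inner, complete_space} \<times> real) set"
  assumes Q: "subspace Q" and C: "\<And>u s. (u, s) \<in> Q \<Longrightarrow> \<bar>s\<bar> \<le> C * norm u"
  obtains w where "w \<in> closure (fst ` Q)" "\<And>u s. (u, s) \<in> Q \<Longrightarrow> w \<bullet> u = s"
proof -
  define J where "J = (\<lambda>(u::'h, s). (norm u)\<^sup>2 - 2 * s)"
  have J_lower: "- (C\<^sup>2) \<le> J q" if "q \<in> Q" for q
  proof -
    obtain u s where q: "q = (u, s)" by fastforce
    have "2 * s \<le> 2 * (C * norm u)" using C[of u s] that q by auto
    also have "\<dots> \<le> C\<^sup>2 + (norm u)\<^sup>2"
      using sum_squares_bound[of C "norm u"] by simp
    finally show ?thesis by (simp add: J_def q)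
  qed
  have Q0: "0 \<in> Q" using Q by (rule subspace_0)
  define m where "m = Inf (J ` Q)"
  have bdd: "bdd_below (J ` Q)"
    using J_lower by (intro bdd_belowI[where m = "- (C\<^sup>2)"]) auto
  have m_le: "m \<le> J q" if "q \<in> Q" for q
    unfolding m_def using bdd that by (intro cInf_lower) auto
  have "\<exists>q\<in>Q. J q < m + 1 / real (Suc n)" for n
  proof -
    have "Inf (J ` Q) < m + 1 / real (Suc n)" by (simp add: m_def)
    then show ?thesis using cInf_lessD[of "J ` Q"] Q0 by blast
  qed
  then obtain q where q: "\<And>n. q n \<in> Q" and Jq: "\<And>n. J (q n) < m + 1 / real (Suc n)"
    by metis
  define U where "U n = fst (q n)" for n
  define T where "T n = snd (q n)" for n
  have UT: "q n = (U n, T n)" for n by (simp add: U_def T_def)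
  have J_lim: "(\<lambda>n. J (q n)) \<longlonglongrightarrow> m"
  proof (rule tendsto_sandwich[of "\<lambda>_. m" _ _ "\<lambda>n. m + 1 / real (Suc n)"])
    show "(\<lambda>n. m + 1 / real (Suc n)) \<longlonglongrightarrow> m"
      using tendsto_add[OF tendsto_const LIMSEQ_inverse_real_of_nat, of m]
      by (simp add: inverse_eq_divide)
  qed (use q m_le Jq in \<open>auto intro!: always_eventually less_imp_le\<close>)
  have par: "(norm (U i - U j))\<^sup>2 \<le> 2 / real (Suc i) + 2 / real (Suc j)" for i j
  proof -
    have "(1/2) *\<^sub>R (q i + q j) \<in> Q" using Q q by (intro subspace_scale subspace_add)
    then have "m \<le> J ((1/2) *\<^sub>R (q i + q j))" by (rule m_le)
    also have "\<dots> = (J (q i) + J (q j)) / 2 - (norm (U i - U j))\<^sup>2 / 4"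
      by (simp add: J_def UT power2_norm_eq_inner inner_simps inner_commute field_simps)
    finally have "(norm (U i - U j))\<^sup>2 \<le> 2 * (J (q i) - m) + 2 * (J (q j) - m)"
      by (simp add: field_simps)
    also have "\<dots> \<le> 2 * (1 / real (Suc i)) + 2 * (1 / real (Suc j))"
      using Jq[of i] Jq[of j]
      by (intro add_mono mult_left_mono) (auto simp only: diff_le_eq add.commute dest: less_imp_le)
    finally show ?thesis by simp
  qed
  have "Cauchy U"
  proof (rule metric_CauchyI)
    fix e :: real assume e: "e > 0"
    then obtain N :: nat where N: "4 / e\<^sup>2 < real N" using reals_Archimedean2 by blast
    have Np: "real N > 0" using N e by (meson divide_pos_pos less_trans zero_less_numeral zero_less_power)
    have "dist (U i) (U j) < e" if "i \<ge> N" "j \<ge> N" for i j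
    proof -
      have "2 / real (Suc k) \<le> 2 / real N" if "k \<ge> N" for k
        using that Np by (intro divide_left_mono) auto
      from this[OF that(1)] this[OF that(2)]
      have "(norm (U i - U j))\<^sup>2 \<le> 4 / real N" using par[of i j] by simp
      also have "\<dots> < e\<^sup>2" using N Np e by (simp add: field_simps)
      finally show ?thesis using e by (simp add: dist_norm power_less_imp_less_base)
    qed
    then show "\<exists>N. \<forall>i\<ge>N. \<forall>j\<ge>N. dist (U i) (U j) < e" by blast
  qed
  then obtain w where w: "U \<longlonglongrightarrow> w" using Cauchy_convergent convergent_def by blast
  show thesis
  proof
    have "U n \<in> fst ` Q" for n using q[of n] UT by force
    then show "w \<in> closure (fst ` Q)" using w closure_sequential by blast
  next
    fix u s assume us: "(u, s) \<in> Q"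
    have var: "0 \<le> 2 * t * (w \<bullet> u - s) + t\<^sup>2 * (norm u)\<^sup>2" for t
    proof -
      have "m - J (q n) \<le> 2 * t * (U n \<bullet> u - s) + t\<^sup>2 * (norm u)\<^sup>2" for n
      proof -
        have "q n + t *\<^sub>R (u, s) \<in> Q" using Q q us by (intro subspace_scale subspace_add)
        then have "m \<le> J (q n + t *\<^sub>R (u, s))" by (rule m_le)
        also have "\<dots> = J (q n) + 2 * t * (U n \<bullet> u - s) + t\<^sup>2 * (norm u)\<^sup>2"
          by (simp add: J_def UT power2_norm_eq_inner inner_simps inner_commute)
            (simp add: algebra_simps power2_eq_square)
        finally show ?thesis by simp
      qed
      moreover have "(\<lambda>n. m - J (q n)) \<longlonglongrightarrow> m - m" by (intro tendsto_intros J_lim)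
      moreover have "(\<lambda>n. 2 * t * (U n \<bullet> u - s) + t\<^sup>2 * (norm u)\<^sup>2)
          \<longlonglongrightarrow> 2 * t * (w \<bullet> u - s) + t\<^sup>2 * (norm u)\<^sup>2"
        by (intro tendsto_intros w)
      ultimately have "m - m \<le> 2 * t * (w \<bullet> u - s) + t\<^sup>2 * (norm u)\<^sup>2"
        by (intro LIMSEQ_le) auto
      then show ?thesis by simp
    qed
    show "w \<bullet> u = s"
    proof (cases "u = 0")
      case True
      then show ?thesis using C[OF us] by simp
    next
      case False
      define d where "d = w \<bullet> u - s"
      define N where "N = (norm u)\<^sup>2"
      have N: "N > 0" using False by (simp add: N_def)
      have "0 \<le> 2 * (- d / N) * d + (- d / N)\<^sup>2 * N" using var[of "- d / N"] by (simp add: d_def N_def)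
      also have "\<dots> = - (d\<^sup>2 / N)" using N by (simp add: power2_eq_square field_simps)
      finally have "d\<^sup>2 / N \<le> 0" by simp
      then have "d = 0" using N by (simp add: divide_le_0_iff)
      then show ?thesis by (simp add: d_def)
    qed
  qed
qed

lemma subspace_closure:
  fixes V :: "'h::real_normed_vector set"
  assumes "subspace V"
  shows "subspace (closure V)"
proof (rule subspaceI)
  show "0 \<in> closure V" using subspace_0[OF assms] closure_subset by blast
next
  fix x y assume "x \<in> closure V" "y \<in> closure V"
  then obtain p q where "\<forall>n. p n \<in> V" "p \<longlonglongrightarrow> x" "\<forall>n. q n \<in> V" "q \<longlonglongrightarrow> y"
    unfolding closure_sequential by blast
  then show "x + y \<in> closure V"
    unfolding closure_sequential using assms
    by (intro exI[of _ "\<lambda>n. p n + q n"]) (auto intro: tendsto_add subspace_add)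
next
  fix c and x assume "x \<in> closure V"
  then obtain p where "\<forall>n. p n \<in> V" "p \<longlonglongrightarrow> x"
    unfolding closure_sequential by blast
  then show "c *\<^sub>R x \<in> closure V"
    unfolding closure_sequential using assms
    by (intro exI[of _ "\<lambda>n. c *\<^sub>R p n"]) (auto intro: tendsto_scaleR subspace_scale)
qed

lemma span_image_finite_sum:
  assumes "x \<in> span (e ` I)"
  obtains F a where "finite F" "F \<subseteq> I" "x = (\<Sum>i\<in>F. a i *\<^sub>R e i)"
proof -
  have "\<exists>F a. finite F \<and> F \<subseteq> I \<and> x = (\<Sum>i\<in>F. a i *\<^sub>R e i)"
    using assms
  proof (induction rule: span_induct_alt)
    case base
    then show ?case by (intro exI[of _ "{}"]) auto
  next
    case (step c y z)
    obtain i where i: "i \<in> I" "y = e i" using step(1) by auto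
    obtain F a where F: "finite F" "F \<subseteq> I" "z = (\<Sum>i\<in>F. a i *\<^sub>R e i)" using step(2) by blast
    define a' where "a' = (\<lambda>j. (if j \<in> F then a j else 0) + (if j = i then c else 0))"
    have "(\<Sum>j\<in>insert i F. a' j *\<^sub>R e j)
        = (\<Sum>j\<in>insert i F. (if j \<in> F then a j else 0) *\<^sub>R e j)
        + (\<Sum>j\<in>insert i F. (if j = i then c else 0) *\<^sub>R e j)"
      by (simp add: a'_def scaleR_add_left sum.distrib)
    also have "(\<Sum>j\<in>insert i F. (if j \<in> F then a j else 0) *\<^sub>R e j) = z"
      unfolding F(3) using F(1) by (intro sum.mono_neutral_cong_right) auto
    also have "(\<Sum>j\<in>insert i F. (if j = i then c else 0) *\<^sub>R e j) = c *\<^sub>R y"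
      using F(1) i by (subst sum.remove[of _ i]) (auto intro!: sum.neutral)
    finally have "c *\<^sub>R y + z = (\<Sum>j\<in>insert i F. a' j *\<^sub>R e j)" by simp
    then show ?case using F i by (intro exI[of _ "insert i F"] exI[of _ a']) auto
  qed
  then show thesis using that by blast
qed

text \<open>
  The form in which the representation theorem is used: the values \<open>t\<close> are compatible with all
  linear relations between the vectors \<open>e\<close> because of the bound by the norm.
\<close>

lemma Riesz_moments:
  fixes e :: "'i \<Rightarrow> 'h::{real_inner, complete_space}"
  assumes "\<And>F a. finite F \<Longrightarrow> F \<subseteq> I \<Longrightarrow>
    \<bar>\<Sum>i\<in>F. a i * t i\<bar> \<le> C * norm (\<Sum>i\<in>F. a i *\<^sub>R e i)"
  obtains w where "w \<in> closure (span (e ` I))" "\<And>i. i \<in> I \<Longrightarrow> w \<bullet> e i = t i"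
proof -
  let ?Q = "span ((\<lambda>i. (e i, t i)) ` I)"
  have bd: "\<bar>s\<bar> \<le> C * norm u" if us: "(u, s) \<in> ?Q" for u s
  proof -
    obtain F a where F: "finite F" "F \<subseteq> I" and eq: "(u, s) = (\<Sum>i\<in>F. a i *\<^sub>R (e i, t i))"
      using span_image_finite_sum[OF us] by metis
    have "u = (\<Sum>i\<in>F. a i *\<^sub>R e i)" "s = (\<Sum>i\<in>F. a i * t i)"
      using arg_cong[OF eq, of fst] arg_cong[OF eq, of snd] by (simp_all add: fst_sum snd_sum)
    then show ?thesis using assms[OF F] by simp
  qed
  obtain w where w: "w \<in> closure (fst ` ?Q)" "\<And>u s. (u, s) \<in> ?Q \<Longrightarrow> w \<bullet> u = s"
    by (rule Riesz_graph[OF subspace_span, of _ C]) (use bd in blast)+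
  have "fst ` ?Q = span (fst ` (\<lambda>i. (e i, t i)) ` I)"
    by (rule linear_span_image[symmetric]) (simp add: linear_fst)
  then have "fst ` ?Q = span (e ` I)" by (simp add: image_image)
  moreover have "w \<bullet> e i = t i" if "i \<in> I" for i
    using that by (intro w(2) span_base) auto
  ultimately show thesis using that w(1) by auto
qed

section \<open>Vectors with a prescribed Gram matrix\<close>

definition psd_kernel :: "('i \<Rightarrow> 'i \<Rightarrow> real) \<Rightarrow> bool" where
  "psd_kernel K \<longleftrightarrow> (\<forall>i j. K i j = K j i) \<and>
     (\<forall>F a. finite F \<longrightarrow> 0 \<le> (\<Sum>i\<in>F. \<Sum>j\<in>F. a i * a j * K i j))"

lemma norm_square_sum:
  fixes e :: "'i \<Rightarrow> 'h::real_inner"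
  shows "(norm (\<Sum>i\<in>F. a i *\<^sub>R e i))\<^sup>2 = (\<Sum>i\<in>F. \<Sum>j\<in>F. a i * a j * (e i \<bullet> e j))"
  by (simp add: power2_norm_eq_inner inner_sum_left inner_sum_right sum_distrib_left mult_ac inner_commute)

text \<open>
  Two functionals that agree on a family agree on its closed span. Together with the next lemma this
  gives all uniqueness statements about vectors that are defined by their inner products.
\<close>

lemma inner_mem_closure_eq:
  fixes x y :: "'h::real_inner"
  assumes w: "w \<in> closure (span B)" and eq: "\<And>u. u \<in> B \<Longrightarrow> x \<bullet> u = y \<bullet> u"
  shows "x \<bullet> w = y \<bullet> w"
proof -
  have "subspace {u. x \<bullet> u = y \<bullet> u}"
    by (auto simp: subspace_def inner_simps)
  then have "span B \<subseteq> {u. x \<bullet> u = y \<bullet> u}" using eq by (intro span_minimal) auto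
  moreover have "closed {u. x \<bullet> u = y \<bullet> u}"
    by (intro closed_Collect_eq continuous_intros)
  ultimately show ?thesis using w closure_minimal by blast
qed

lemma closure_span_eqI:
  fixes x y :: "'h::real_inner"
  assumes "x \<in> closure (span B)" "y \<in> closure (span B)" "\<And>u. u \<in> B \<Longrightarrow> x \<bullet> u = y \<bullet> u"
  shows "x = y"
proof -
  have "x \<bullet> x = y \<bullet> x" "x \<bullet> y = y \<bullet> y" using assms inner_mem_closure_eq by blast+
  then have "(x - y) \<bullet> (x - y) = 0" by (simp add: inner_simps inner_commute)
  then show ?thesis by simp
qed

lift_definition ell2_single :: "'i \<Rightarrow> 'i ell2" is "\<lambda>i j. if j = i then 1 else 0"
proof -
  fix i :: 'i
  have "(\<lambda>j. (if j = i then 1 else 0 :: real)\<^sup>2) summable_on {i}" by simp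
  then show "(\<lambda>j. (if j = i then 1 else 0 :: real)\<^sup>2) summable_on UNIV"
    by (rule summable_on_cong_neutral[THEN iffD1, rotated -1]) auto
qed

lemma inner_ell2_single: "x \<bullet> ell2_single i = ell2_nth x i"
proof -
  have "x \<bullet> ell2_single i = (\<Sum>\<^sub>\<infinity>j\<in>{i}. ell2_nth x j * ell2_nth (ell2_single i) j)"
    unfolding inner_ell2_def by (rule infsum_cong_neutral) (auto simp: ell2_single.rep_eq)
  then show ?thesis by (simp add: ell2_single.rep_eq)
qed

lemma inner_ell2_single_left: "ell2_single i \<bullet> x = ell2_nth x i"
  by (subst inner_commute) (rule inner_ell2_single)

text \<open>
  This is the Gram-Schmidt process (Cholesky factorization) along a well-ordering of the index type:
  \<open>b i\<close> is the vector in the closed span of the earlier ones that has the right inner products with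
  them, plus a multiple of the \<open>i\<close>-th unit vector that corrects the norm. By induction \<open>b j\<close> is
  supported on the indices up to \<open>j\<close>, so the \<open>i\<close>-th unit vector is orthogonal to everything
  constructed before stage \<open>i\<close>. In this way no Hilbert space has to be built from the kernel and then
  embedded by counting an orthonormal basis.
\<close>

lemma psd_kernel_Gram:
  fixes K :: "'i \<Rightarrow> 'i \<Rightarrow> real"
  assumes K: "psd_kernel K"
  obtains b :: "'i \<Rightarrow> 'i ell2" where "\<And>i j. b i \<bullet> b j = K i j"
proof -
  have sym: "K i j = K j i" for i j using K by (simp add: psd_kernel_def)
  have psd: "0 \<le> (\<Sum>i\<in>F. \<Sum>j\<in>F. a i * a j * K i j)" if "finite F" for F a
    using K that by (simp add: psd_kernel_def)
  obtain r :: "'i rel" where r: "well_order_on UNIV r" using well_order_on by blast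
  define R where "R = r - Id"
  have wf: "wf R" using r by (simp add: R_def well_order_on_def)
  have tot: "(i, j) \<in> R \<or> i = j \<or> (j, i) \<in> R" for i j
    using r by (auto simp: R_def well_order_on_def linear_order_on_def total_on_def)
  have trans: "(i, k) \<in> R" if "(i, j) \<in> R" "(j, k) \<in> R" for i j k
  proof -
    have "trans r" "antisym r"
      using r by (auto simp: well_order_on_def linear_order_on_def partial_order_on_def preorder_on_def)
    then show ?thesis using that by (auto simp: R_def dest: transD antisymD)
  qed
  have irrefl: "(i, i) \<notin> R" for i by (simp add: R_def)
  define P where "P f i v \<longleftrightarrow>
      (\<forall>j. (j, i) \<in> R \<longrightarrow> v \<bullet> f j = K i j) \<and> v \<bullet> v = K i i \<and>
      (\<forall>j. ell2_nth v j \<noteq> 0 \<longrightarrow> j = i \<or> (j, i) \<in> R)" for f :: "'i \<Rightarrow> 'i ell2" and i v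
  have "\<exists>f. \<forall>i. P f i (f i)"
  proof (rule dependent_wf_choice[OF wf])
    fix f g :: "'i \<Rightarrow> 'i ell2" and i v
    assume "\<And>j. (j, i) \<in> R \<Longrightarrow> f j = g j"
    then show "P f i v = P g i v" by (simp add: P_def)
  next
    fix i and f :: "'i \<Rightarrow> 'i ell2"
    assume IH: "\<And>j. (j, i) \<in> R \<Longrightarrow> P f j (f j)"
    define I where "I = {j. (j, i) \<in> R}"
    have Gram: "f j \<bullet> f k = K j k" if "j \<in> I" "k \<in> I" for j k
      using tot[of j k] IH[of j] IH[of k] that sym by (auto simp: I_def P_def inner_commute)
    have norm_f: "(norm (\<Sum>j\<in>F. a j *\<^sub>R f j))\<^sup>2 = (\<Sum>j\<in>F. \<Sum>k\<in>F. a j * a k * K j k)"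
      if "F \<subseteq> I" for F a
      unfolding norm_square_sum using that by (intro sum.cong refl) (simp add: Gram subset_iff)
    \<comment> \<open>Positivity of the kernel for the combination of the indices in \<open>F\<close> with coefficients \<open>a\<close> and
      of \<open>i\<close> with coefficient \<open>- t\<close>; the discriminant in \<open>t\<close> gives a Cauchy-Schwarz inequality.\<close>
    have quad: "0 \<le> K i i * t\<^sup>2 - 2 * t * (\<Sum>j\<in>F. a j * K i j) + (norm (\<Sum>j\<in>F. a j *\<^sub>R f j))\<^sup>2"
      if F: "finite F" "F \<subseteq> I" for F a t
    proof -
      have iF: "i \<notin> F" using F irrefl by (auto simp: I_def)
      let ?a = "\<lambda>j. if j = i then - t else a j"
      have "0 \<le> (\<Sum>j\<in>insert i F. \<Sum>k\<in>insert i F. ?a j * ?a k * K j k)"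
        using F by (intro psd) auto
      also have "\<dots> = t\<^sup>2 * K i i + (\<Sum>k\<in>F. - t * a k * K i k)
          + ((\<Sum>j\<in>F. - t * a j * K j i) + (\<Sum>j\<in>F. \<Sum>k\<in>F. a j * a k * K j k))"
      proof -
        have "(\<Sum>k\<in>insert i F. ?a j * ?a k * K j k) = ?a j * (- t) * K j i + (\<Sum>k\<in>F. ?a j * a k * K j k)"
          for j
        proof -
          have "(\<Sum>k\<in>F. ?a j * ?a k * K j k) = (\<Sum>k\<in>F. ?a j * a k * K j k)"
            using iF by (intro sum.cong) auto
          then show ?thesis using F(1) iF by (subst sum.insert) auto
        qed
        then have "(\<Sum>j\<in>insert i F. \<Sum>k\<in>insert i F. ?a j * ?a k * K j k)
          = (\<Sum>j\<in>insert i F. ?a j * (- t) * K j i + (\<Sum>k\<in>F. ?a j * a k * K j k))" by simp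
        also have "\<dots> = t\<^sup>2 * K i i + (\<Sum>k\<in>F. - t * a k * K i k)
            + (\<Sum>j\<in>F. ?a j * (- t) * K j i + (\<Sum>k\<in>F. ?a j * a k * K j k))"
          using F(1) iF by (simp add: power2_eq_square)
        also have "(\<Sum>j\<in>F. ?a j * (- t) * K j i + (\<Sum>k\<in>F. ?a j * a k * K j k))
            = (\<Sum>j\<in>F. - t * a j * K j i + (\<Sum>k\<in>F. a j * a k * K j k))"
          using iF by (intro sum.cong) (auto simp: mult.commute)
        finally show ?thesis by (simp only: sum.distrib)
      qed
      also have "\<dots> = K i i * t\<^sup>2 - 2 * t * (\<Sum>j\<in>F. a j * K i j) + (norm (\<Sum>j\<in>F. a j *\<^sub>R f j))\<^sup>2"
      proof -
        have "(\<Sum>j\<in>F. - t * a j * K j i) = (\<Sum>j\<in>F. - t * a j * K i j)"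
          using sym by (intro sum.cong) auto
        moreover have "(\<Sum>j\<in>F. - t * a j * K i j) = - t * (\<Sum>j\<in>F. a j * K i j)"
          by (simp add: sum_distrib_left mult.assoc)
        ultimately show ?thesis unfolding norm_f[OF F(2)] by simp
      qed
      finally show ?thesis .
    qed
    have Kii: "0 \<le> K i i" using quad[of "{}" 1] by simp
    have "\<bar>\<Sum>j\<in>F. a j * K i j\<bar> \<le> sqrt (K i i) * norm (\<Sum>j\<in>F. a j *\<^sub>R f j)"
      if F: "finite F" "F \<subseteq> I" for F a
    proof -
      define x where "x = (\<Sum>j\<in>F. a j * K i j)"
      define N where "N = (norm (\<Sum>j\<in>F. a j *\<^sub>R f j))\<^sup>2"
      have q: "0 \<le> K i i * t\<^sup>2 - 2 * t * x + N" for t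
        using quad[OF F, of t a] by (simp add: x_def N_def)
      have "x\<^sup>2 \<le> K i i * N"
      proof (cases "K i i = 0")
        case True
        have "x = 0"
        proof (rule ccontr)
          assume "x \<noteq> 0"
          then show False using q[of "(N + 1) / (2 * x)"] True by (simp add: field_simps)
        qed
        then show ?thesis using True by simp
      next
        case False
        then have "K i i > 0" using Kii by simp
        then show ?thesis using q[of "x / K i i"] by (simp add: power2_eq_square field_simps)
      qed
      then have "sqrt (x\<^sup>2) \<le> sqrt (K i i * N)" by (rule real_sqrt_le_mono)
      then show ?thesis by (simp add: real_sqrt_mult x_def N_def)
    qed
    then obtain v where v: "v \<in> closure (span (f ` I))" and vf: "\<And>j. j \<in> I \<Longrightarrow> v \<bullet> f j = K i j"
      using Riesz_moments[of I "\<lambda>j. K i j" "sqrt (K i i)" f] by metis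
    \<comment> \<open>The vectors of the closed span have no component outside \<open>I\<close>, so that the coordinate \<open>i\<close> is free.\<close>
    have supp: "ell2_nth v j = 0" if "j \<notin> I" for j
    proof -
      have "ell2_single j \<bullet> f k = 0 \<bullet> f k" if "k \<in> I" for k
      proof -
        have "ell2_nth (f k) j = 0" using IH[of k] \<open>j \<notin> I\<close> that trans unfolding P_def I_def by blast
        then show ?thesis by (simp add: inner_ell2_single_left)
      qed
      then have "ell2_single j \<bullet> v = 0 \<bullet> v" by (intro inner_mem_closure_eq[OF v]) auto
      then show ?thesis by (simp add: inner_ell2_single_left)
    qed
    \<comment> \<open>\<open>K i i - 2 (v \<bullet> u) + u \<bullet> u\<close> is the squared distance that \<open>b i\<close> must have from \<open>u\<close>. It is
      nonnegative on the closed span, in particular at the projection \<open>u = v\<close>.\<close>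
    have vv: "v \<bullet> v \<le> K i i"
    proof -
      have "0 \<le> K i i - 2 * (v \<bullet> u) + u \<bullet> u" if us: "u \<in> span (f ` I)" for u
      proof -
        obtain F a where F: "finite F" "F \<subseteq> I" and u: "u = (\<Sum>j\<in>F. a j *\<^sub>R f j)"
          using span_image_finite_sum[OF us] by metis
        have "v \<bullet> u = (\<Sum>j\<in>F. a j * K i j)"
          using F vf by (auto simp: u inner_sum_right intro!: sum.cong)
        then show ?thesis using quad[OF F, of 1 a] by (simp add: u power2_norm_eq_inner)
      qed
      then have "span (f ` I) \<subseteq> {u. 0 \<le> K i i - 2 * (v \<bullet> u) + u \<bullet> u}" by blast
      moreover have "closed {u. 0 \<le> K i i - 2 * (v \<bullet> u) + u \<bullet> u}"
        by (intro closed_Collect_le continuous_intros)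
      ultimately have "0 \<le> K i i - 2 * (v \<bullet> v) + v \<bullet> v" using v closure_minimal by blast
      then show ?thesis by simp
    qed
    define c where "c = sqrt (K i i - v \<bullet> v)"
    let ?w = "v + c *\<^sub>R ell2_single i"
    have iI: "i \<notin> I" using irrefl by (simp add: I_def)
    have "?w \<bullet> f j = K i j" if "(j, i) \<in> R" for j
    proof -
      have "i \<noteq> j" "(i, j) \<notin> R" using that trans irrefl by blast+
      then have "ell2_nth (f j) i = 0" using IH[OF that] unfolding P_def by blast
      then have "ell2_single i \<bullet> f j = 0" by (simp add: inner_ell2_single_left)
      then show ?thesis using vf[of j] that by (simp add: inner_simps I_def)
    qed
    moreover have "?w \<bullet> ?w = K i i"
    proof -
      have "v \<bullet> ell2_single i = 0" "ell2_single i \<bullet> ell2_single i = 1"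
        using supp[OF iI] by (simp_all add: inner_ell2_single ell2_single.rep_eq)
      then have "?w \<bullet> ?w = v \<bullet> v + c\<^sup>2"
        by (simp add: inner_simps inner_commute[of "ell2_single i" v] power2_eq_square)
      then show ?thesis using vv by (simp add: c_def)
    qed
    moreover have "j = i \<or> (j, i) \<in> R" if "ell2_nth ?w j \<noteq> 0" for j
      using that supp[of j] by (auto simp: I_def ell2_single.rep_eq split: if_splits)
    ultimately show "\<exists>w. P f i w" unfolding P_def by blast
  qed
  then obtain b where b: "\<And>i. P b i (b i)" by blast
  have "b i \<bullet> b j = K i j" for i j
    using tot[of i j] b[of i] b[of j] sym by (auto simp: P_def inner_commute)
  then show thesis using that by blast
qed

section \<open>From an invariant Gram matrix to a cocycle\<close>

text \<open>
  The hypothesis says that \<open>b h \<mapsto> b (g + h) - b g\<close> preserves inner products, so it extends to a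
  linear isometry of the closed span \<open>V\<close> of \<open>b\<close>; these isometries form a representation, and they
  are made into orthogonal transformations of the whole space by the identity on the complement of
  \<open>V\<close>. The operator \<open>A g\<close> is this isometry composed with the projection onto \<open>V\<close>, so that \<open>A 0\<close> is
  the projection itself. Continuity at \<open>0\<close> propagates to all of the group because
  $\|b(g) - b(h)\| = \|b(h^{-1}g)\|$.
\<close>

lemma cocycle_of_invariant_increments:
  fixes b :: "'g::topological_group_add \<Rightarrow> 'h::{real_inner, complete_space}"
  assumes inv: "\<And>g h k. (b (g + h) - b g) \<bullet> (b (g + k) - b g) = b h \<bullet> b k"
    and cont0: "(b \<longlongrightarrow> 0) (nhds 0)"
  obtains \<pi> where "one_cocycle \<pi> b"
proof -
  define d where "d g h = b (g + h) - b g" for g h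
  have d_inner: "d g h \<bullet> d g k = b h \<bullet> b k" for g h k
    using inv by (simp add: d_def)
  have b0: "b 0 = 0" using d_inner[of 0 0 0] by (simp add: d_def)
  define V where "V = closure (span (range b))"
  have b_V: "b g \<in> V" for g
    unfolding V_def using span_base[of "b g" "range b"] closure_subset by blast
  have V: "subspace V" unfolding V_def by (intro subspace_closure subspace_span)
  have V_eqI: "x = y" if "x \<in> V" "y \<in> V" "\<And>h. x \<bullet> b h = y \<bullet> b h" for x y
    using closure_span_eqI[of x "range b" y] that by (auto simp: V_def)
  have V_inner: "x \<bullet> w = y \<bullet> w" if "w \<in> V" "\<And>h. x \<bullet> b h = y \<bullet> b h" for x y w
    using inner_mem_closure_eq[of w "range b" x y] that by (auto simp: V_def)
  have norm_d: "norm (\<Sum>h\<in>F. a h *\<^sub>R d g h) = norm (\<Sum>h\<in>F. a h *\<^sub>R b h)" for F a g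
  proof -
    have "(norm (\<Sum>h\<in>F. a h *\<^sub>R d g h))\<^sup>2 = (norm (\<Sum>h\<in>F. a h *\<^sub>R b h))\<^sup>2"
      by (simp only: norm_square_sum d_inner)
    then show ?thesis by (simp add: power2_eq_iff_nonneg)
  qed
  have test: "\<bar>\<Sum>h\<in>F. a h * (x \<bullet> d g h)\<bar> \<le> norm x * norm (\<Sum>h\<in>F. a h *\<^sub>R b h)" for F a x g
  proof -
    have "(\<Sum>h\<in>F. a h * (x \<bullet> d g h)) = x \<bullet> (\<Sum>h\<in>F. a h *\<^sub>R d g h)"
      by (simp add: inner_sum_right)
    then show ?thesis using Cauchy_Schwarz_ineq2[of x "\<Sum>h\<in>F. a h *\<^sub>R d g h"] by (simp only: norm_d)
  qed
  \<comment> \<open>\<open>A g\<close> is defined as the adjoint of the isometry that belongs to \<open>- g\<close>. This uses the values of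
    that isometry only at the vectors \<open>b h\<close>, and it is defined on the whole space at once.\<close>
  have "\<exists>w. w \<in> V \<and> (\<forall>h. w \<bullet> b h = x \<bullet> d (- g) h)" for g x
    by (rule Riesz_moments[where I = UNIV and e = b, OF test]) (auto simp: V_def)
  then have "\<exists>A. \<forall>g x. A g x \<in> V \<and> (\<forall>h. A g x \<bullet> b h = x \<bullet> d (- g) h)"
    by (intro choice allI)
  then obtain A where A_V: "\<And>g x. A g x \<in> V" and A: "\<And>g x h. A g x \<bullet> b h = x \<bullet> d (- g) h"
    by blast
  have A_b: "A g (b h) = d g h" for g h
  proof (rule V_eqI)
    show "d g h \<in> V" unfolding d_def using V b_V by (intro subspace_diff)
    show "A g (b h) \<bullet> b k = d g h \<bullet> b k" for k
    proof -
      have "A g (b h) \<bullet> b k = b h \<bullet> b (- g + k) - b h \<bullet> b (- g)"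
        by (simp add: A d_def inner_diff_right)
      also have "\<dots> = d g h \<bullet> d g (- g + k) - d g h \<bullet> d g (- g)" by (simp only: d_inner)
      also have "\<dots> = d g h \<bullet> b k" by (simp add: d_def b0 inner_simps flip: add.assoc)
      finally show ?thesis .
    qed
  qed (rule A_V)
  have A_add: "A g (x + y) = A g x + A g y" for g x y
    by (rule V_eqI) (auto simp: A inner_simps intro: subspace_add[OF V] A_V)
  have A_scale: "A g (c *\<^sub>R x) = c *\<^sub>R A g x" for g c x
    by (rule V_eqI) (auto simp: A inner_simps intro: subspace_scale[OF V] A_V)
  have A_diff: "A g (x - y) = A g x - A g y" for g x y
    by (rule V_eqI) (auto simp: A inner_simps intro: subspace_diff[OF V] A_V)
  have A_comp: "A g (A h x) = A (g + h) x" for g h x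
  proof (rule V_eqI)
    show "A g (A h x) \<bullet> b k = A (g + h) x \<bullet> b k" for k
      by (simp only: A d_def inner_diff_right minus_add add.assoc)
  qed (rule A_V)+
  have A_norm: "norm (A g x) \<le> norm x" for g x
  proof -
    have "span (range b) \<subseteq> {u. A g x \<bullet> u \<le> norm x * norm u}"
    proof clarify
      fix u assume "u \<in> span (range b)"
      then obtain F a where u: "u = (\<Sum>h\<in>F. a h *\<^sub>R b h)"
        using span_image_finite_sum by metis
      have "A g x \<bullet> u = (\<Sum>h\<in>F. a h * (x \<bullet> d (- g) h))" by (simp add: u inner_sum_right A)
      then show "A g x \<bullet> u \<le> norm x * norm u" using test[where F=F and a=a] u by (metis abs_le_D1)
    qed
    moreover have "closed {u. A g x \<bullet> u \<le> norm x * norm u}"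
      by (intro closed_Collect_le continuous_intros)
    ultimately have "A g x \<bullet> A g x \<le> norm x * norm (A g x)"
      using A_V[of g x] closure_minimal unfolding V_def by blast
    then show ?thesis
      by (cases "A g x = 0") (auto simp: power2_norm_eq_inner[symmetric] power2_eq_square)
  qed
  define \<pi> where "\<pi> g x = A g x + (x - A 0 x)" for g x
  have perp: "(x - A 0 x) \<bullet> w = 0" if "w \<in> V" for x w
    using V_inner[OF that, of "x - A 0 x" 0] by (simp add: A d_def b0 inner_simps)
  have A0: "A g x = A g (A 0 x)" for g x by (simp add: A_comp)
  have pi_0: "\<pi> 0 = id" by (simp add: \<pi>_def fun_eq_iff)
  have pi_add: "\<pi> (g + h) = \<pi> g \<circ> \<pi> h" for g h
    by (simp add: \<pi>_def fun_eq_iff A_add A_diff A_comp)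
  have pi_linear: "linear (\<pi> g)" for g
    by (rule linearI) (simp_all add: \<pi>_def A_add A_scale algebra_simps)
  have pi_le: "norm (\<pi> g x) \<le> norm x" for g x
  proof -
    have Pyth: "(norm (w + (x - A 0 x)))\<^sup>2 = (norm w)\<^sup>2 + (norm (x - A 0 x))\<^sup>2" if "w \<in> V" for w
    proof -
      have "w \<bullet> (x - A 0 x) = 0" using perp[OF that, of x] by (subst inner_commute)
      with perp[OF that, of x] show ?thesis
        by (simp only: power2_norm_eq_inner inner_add_left inner_add_right)
    qed
    have "(norm (\<pi> g x))\<^sup>2 = (norm (A g (A 0 x)))\<^sup>2 + (norm (x - A 0 x))\<^sup>2"
      unfolding \<pi>_def using Pyth[OF A_V[of g x]] A0[of g x] by simp
    also have "\<dots> \<le> (norm (A 0 x))\<^sup>2 + (norm (x - A 0 x))\<^sup>2"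
      by (intro add_right_mono power_mono A_norm norm_ge_zero)
    also have "\<dots> = (norm x)\<^sup>2" using Pyth[OF A_V[of 0 x]] by simp
    finally show ?thesis by (simp add: power2_le_iff_abs_le)
  qed
  \<comment> \<open>A contraction whose inverse is a contraction is isometric.\<close>
  have pi_norm: "norm (\<pi> g x) = norm x" for g x
  proof (rule antisym[OF pi_le])
    have "x = \<pi> (- g) (\<pi> g x)" using pi_add[of "- g" g] pi_0 by (simp add: fun_eq_iff)
    then show "norm x \<le> norm (\<pi> g x)" using pi_le by metis
  qed
  have cocycle: "b (g + h) = \<pi> g (b h) + b g" for g h
    using A_b[of 0 h] by (simp add: \<pi>_def A_b d_def b0)
  have b_cont: "continuous_on UNIV b"
    unfolding continuous_on_def
  proof
    fix h :: 'g
    have "((\<lambda>g. - h + g) \<longlongrightarrow> - h + h) (at h)" by (intro tendsto_intros)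
    then have "((\<lambda>g. b (- h + g)) \<longlongrightarrow> 0) (at h)"
      using filterlim_compose[OF cont0] by simp
    then have "((\<lambda>g. norm (b (- h + g))) \<longlongrightarrow> 0) (at h)" by (rule tendsto_norm_zero)
    moreover have "norm (b (- h + g)) = norm (b g - b h)" for g
    proof -
      have "b g = \<pi> h (b (- h + g)) + b h" using cocycle[of h "- h + g"] by (simp flip: add.assoc)
      then show ?thesis by (simp add: pi_norm)
    qed
    ultimately have "((\<lambda>g. b g - b h) \<longlongrightarrow> 0) (at h)" by (simp add: tendsto_norm_zero_iff)
    then show "(b \<longlongrightarrow> b h) (at h)" by (rule LIM_zero_cancel)
  qed
  \<comment> \<open>The vectors with a continuous orbit form a closed subspace, since all \<open>A g\<close> are contractions.\<close>
  have A_cont: "continuous_on UNIV (\<lambda>g. A g v)" for v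
  proof -
    define Z where "Z = {v. continuous_on UNIV (\<lambda>g. A g v)}"
    have "range b \<subseteq> Z"
    proof clarify
      fix h
      have "continuous_on UNIV (\<lambda>g. b (g + h))"
        by (rule continuous_on_compose2[OF b_cont]) (auto intro!: continuous_intros)
      then show "b h \<in> Z" unfolding Z_def mem_Collect_eq A_b d_def by (intro continuous_intros b_cont)
    qed
    moreover have "subspace Z"
    proof (rule subspaceI)
      have "A g 0 = 0" for g using A_scale[of g 0 0] by simp
      then show "0 \<in> Z" by (simp add: Z_def)
    qed (auto simp: Z_def A_add A_scale intro!: continuous_intros)
    ultimately have "span (range b) \<subseteq> Z" by (rule span_minimal)
    moreover have "closed Z"
      unfolding closed_sequential_limits
    proof clarify
      fix z l assume z: "\<forall>n. z n \<in> Z" and lim: "z \<longlonglongrightarrow> l"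
      have "uniform_limit UNIV (\<lambda>n g. A g (z n)) (\<lambda>g. A g l) sequentially"
      proof (rule uniform_limitI)
        fix e :: real assume "e > 0"
        with lim have "\<forall>\<^sub>F n in sequentially. dist (z n) l < e" by (rule tendstoD)
        then show "\<forall>\<^sub>F n in sequentially. \<forall>g\<in>UNIV. dist (A g (z n)) (A g l) < e"
        proof eventually_elim
          case (elim n)
          have "dist (A g (z n)) (A g l) \<le> dist (z n) l" for g
            using A_norm[of g "z n - l"] by (simp add: dist_norm A_diff)
          then show ?case using elim by (auto intro: le_less_trans)
        qed
      qed
      then have "continuous_on UNIV (\<lambda>g. A g l)"
        using z by (intro uniform_limit_theorem[where F = sequentially]) (auto simp: Z_def)
      then show "l \<in> Z" by (simp add: Z_def)
    qed
    ultimately have "V \<subseteq> Z" unfolding V_def by (rule closure_minimal)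
    then have "A 0 v \<in> Z" using A_V by blast
    then show ?thesis unfolding Z_def mem_Collect_eq by (simp only: A0[symmetric])
  qed
  have "continuous_on UNIV (\<lambda>g. \<pi> g v)" for v
    unfolding \<pi>_def by (intro continuous_intros A_cont)
  then have "one_cocycle \<pi> b"
    unfolding one_cocycle_def orthogonal_representation_def orthogonal_transformation
    using pi_0 pi_add pi_linear pi_norm cocycle b_cont by blast
  then show thesis by (rule that)
qed

lemma cocycle_of_invariant_kernel:
  fixes K :: "'g::topological_group_add \<Rightarrow> 'g \<Rightarrow> real"
  assumes K: "psd_kernel K"
    and inv: "\<And>g h k. K (g + h) (g + k) - K (g + h) g - K g (g + k) + K g g = K h k"
    and cont0: "((\<lambda>g. K g g) \<longlongrightarrow> 0) (nhds 0)"
  obtains \<pi> :: "'g \<Rightarrow> 'g ell2 \<Rightarrow> 'g ell2" and b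
  where "one_cocycle \<pi> b" "\<And>g. (norm (b g))\<^sup>2 = K g g"
proof -
  obtain b :: "'g \<Rightarrow> 'g ell2" where b: "\<And>g h. b g \<bullet> b h = K g h"
    using psd_kernel_Gram[OF K] by metis
  have nb: "(norm (b g))\<^sup>2 = K g g" for g by (simp add: power2_norm_eq_inner b)
  have "((\<lambda>g. sqrt ((norm (b g))\<^sup>2)) \<longlongrightarrow> sqrt 0) (nhds 0)"
    unfolding nb by (intro tendsto_intros cont0)
  then have lim: "(b \<longlongrightarrow> 0) (nhds 0)" by (simp add: tendsto_norm_zero_iff)
  have "(b (g + h) - b g) \<bullet> (b (g + k) - b g) = b h \<bullet> b k" for g h k
    using inv[of g h k] by (simp add: inner_diff_left inner_diff_right b)
  then obtain \<pi> where "one_cocycle \<pi> b" using cocycle_of_invariant_increments[OF _ lim] by metis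
  then show thesis using that nb by blast
qed

section \<open>Averaging a uniformly continuous map\<close>

text \<open>
  Uniform continuity for the left-invariant uniformity, in which \<open>x\<close> and \<open>y\<close> are close if \<open>- x + y\<close>
  is close to \<open>0\<close>. It fits the left-invariant word metric.
\<close>

definition left_uniformly_continuous ::
    "('g::topological_group_add \<Rightarrow> 'h::real_normed_vector) \<Rightarrow> bool" where
  "left_uniformly_continuous F \<longleftrightarrow>
     (\<forall>e>0. \<forall>\<^sub>F g in nhds 0. \<forall>x. norm (F (x + g) - F x) \<le> e)"

lemma left_uniformly_continuous_imp_continuous:
  assumes "left_uniformly_continuous F"
  shows "continuous_on UNIV F"
  unfolding continuous_on_def
proof
  fix x :: 'a
  show "(F \<longlongrightarrow> F x) (at x)"
  proof (rule tendstoI)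
    fix e :: real assume "e > 0"
    then have "\<forall>\<^sub>F g in nhds 0. \<forall>x. norm (F (x + g) - F x) \<le> e / 2"
      using assms unfolding left_uniformly_continuous_def by (meson half_gt_zero)
    moreover have "((\<lambda>y. - x + y) \<longlongrightarrow> - x + x) (at x)" by (intro tendsto_intros)
    then have "((\<lambda>y. - x + y) \<longlongrightarrow> 0) (at x)" by simp
    ultimately have "\<forall>\<^sub>F y in at x. \<forall>z. norm (F (z + (- x + y)) - F z) \<le> e / 2"
      by (rule eventually_compose_filterlim)
    then show "\<forall>\<^sub>F y in at x. dist (F y) (F x) < e"
    proof eventually_elim
      case (elim y)
      have "norm (F (x + (- x + y)) - F x) \<le> e / 2" using elim by blast
      then show ?case using \<open>e > 0\<close> by (simp add: dist_norm flip: add.assoc)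
    qed
  qed
qed

lemma apply_bcontfun_sum: "apply_bcontfun (\<Sum>i\<in>A. \<phi> i) x = (\<Sum>i\<in>A. apply_bcontfun (\<phi> i) x)"
  by (induction A rule: infinite_finite_induct) auto

text \<open>
  The cocycle is the average of the maps \<open>g \<mapsto> F (- x + g) - F (- x)\<close> over \<open>x\<close>, in the sense that
  its Gram matrix is the mean over \<open>x\<close> of their Gram matrices. Translation by \<open>g\<close> replaces \<open>x\<close> by
  \<open>- g + x\<close>, so a left-invariant mean makes the increments of the average invariant. Any bound on
  \<open>norm (F (x + g) - F x)\<close> that is uniform in \<open>x\<close> passes to the average. Uniform continuity of \<open>F\<close> is
  needed twice: the mean acts on continuous functions only, and the cocycle has to be continuous.
\<close>

lemma cocycle_of_amenable_average:
  fixes F :: "'g::topological_group_add \<Rightarrow> 'h::real_inner"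
  assumes am: "amenable TYPE('g)"
    and uc: "left_uniformly_continuous F"
    and bd: "\<And>g. \<exists>B. \<forall>x. norm (F (x + g) - F x) \<le> B"
  obtains \<pi> :: "'g \<Rightarrow> 'g ell2 \<Rightarrow> 'g ell2" and b
  where "one_cocycle \<pi> b"
    "\<And>g r. 0 \<le> r \<Longrightarrow> (\<And>x. r \<le> norm (F (x + g) - F x)) \<Longrightarrow> r \<le> norm (b g)"
    "\<And>g r. (\<And>x. norm (F (x + g) - F x) \<le> r) \<Longrightarrow> norm (b g) \<le> r"
proof -
  obtain m :: "('g \<Rightarrow>\<^sub>C real) \<Rightarrow> real" where m_linear: "linear m"
    and m_pos: "\<And>\<phi>. (\<And>x. 0 \<le> apply_bcontfun \<phi> x) \<Longrightarrow> 0 \<le> m \<phi>"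
    and m_one: "m (const_bcontfun 1) = 1"
    and m_inv: "\<And>g \<phi>. m (left_translate g \<phi>) = m \<phi>"
    using am unfolding amenable_def left_invariant_mean_def by blast
  have m_mono: "m \<phi> \<le> m \<psi>" if "\<And>x. apply_bcontfun \<phi> x \<le> apply_bcontfun \<psi> x" for \<phi> \<psi>
    using m_pos[of "\<psi> - \<phi>"] that by (simp add: linear_diff[OF m_linear])
  have m_const: "m (const_bcontfun c) = c" for c
  proof -
    have "const_bcontfun c = c *\<^sub>R (const_bcontfun 1 :: 'g \<Rightarrow>\<^sub>C real)"
      by (rule bcontfun_eqI) (simp add: const_bcontfun.rep_eq)
    then show ?thesis using m_one by (simp add: linear_scale[OF m_linear])
  qed
  define D where "D g x = F (- x + g) - F (- x)" for g x
  have "continuous_on UNIV F" using uc by (rule left_uniformly_continuous_imp_continuous)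
  then have D_cont: "continuous_on UNIV (D g)" for g
    unfolding D_def
    by (intro continuous_intros continuous_on_compose2[OF \<open>continuous_on UNIV F\<close>]) auto
  define \<phi> where "\<phi> g h = Bcontfun (\<lambda>x. D g x \<bullet> D h x)" for g h
  have \<phi>: "apply_bcontfun (\<phi> g h) x = D g x \<bullet> D h x" for g h x
  proof -
    obtain B where B: "\<And>x. norm (D g x) \<le> B" using bd[of g] by (auto simp: D_def)
    obtain C where C: "\<And>x. norm (D h x) \<le> C" using bd[of h] by (auto simp: D_def)
    have "norm (D g x \<bullet> D h x) \<le> B * C" for x
    proof -
      have "norm (D g x \<bullet> D h x) \<le> norm (D g x) * norm (D h x)"
        by (simp add: Cauchy_Schwarz_ineq2)
      also have "\<dots> \<le> B * C"
        using B C order_trans[OF norm_ge_zero B] by (intro mult_mono) auto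
      finally show ?thesis .
    qed
    then have "(\<lambda>x. D g x \<bullet> D h x) \<in> bcontfun"
      by (intro bcontfun_normI[where b = "B * C"] continuous_intros D_cont)
    then show ?thesis by (simp add: \<phi>_def Bcontfun_inverse)
  qed
  define K where "K g h = m (\<phi> g h)" for g h
  have psd: "psd_kernel K"
    unfolding psd_kernel_def
  proof (intro conjI allI impI)
    show "K g h = K h g" for g h
      unfolding K_def by (rule arg_cong[of _ _ m], rule bcontfun_eqI) (simp add: \<phi> inner_commute)
    fix A and a :: "'g \<Rightarrow> real"
    have "(\<Sum>i\<in>A. \<Sum>j\<in>A. a i * a j * K i j) = m (\<Sum>i\<in>A. \<Sum>j\<in>A. (a i * a j) *\<^sub>R \<phi> i j)"
      by (simp add: K_def linear_sum[OF m_linear] linear_scale[OF m_linear])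
    moreover have "0 \<le> m (\<Sum>i\<in>A. \<Sum>j\<in>A. (a i * a j) *\<^sub>R \<phi> i j)"
    proof (rule m_pos)
      fix x
      have "apply_bcontfun (\<Sum>i\<in>A. \<Sum>j\<in>A. (a i * a j) *\<^sub>R \<phi> i j) x = (norm (\<Sum>i\<in>A. a i *\<^sub>R D i x))\<^sup>2"
        unfolding norm_square_sum by (simp add: apply_bcontfun_sum \<phi>)
      then show "0 \<le> apply_bcontfun (\<Sum>i\<in>A. \<Sum>j\<in>A. (a i * a j) *\<^sub>R \<phi> i j) x" by simp
    qed
    ultimately show "0 \<le> (\<Sum>i\<in>A. \<Sum>j\<in>A. a i * a j * K i j)" by simp
  qed
  have K_inv: "K (g + h) (g + k) - K (g + h) g - K g (g + k) + K g g = K h k" for g h k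
  proof -
    have "left_translate g (\<phi> h k) = \<phi> (g + h) (g + k) - \<phi> (g + h) g - \<phi> g (g + k) + \<phi> g g"
    proof (rule bcontfun_eqI)
      fix x
      have D: "D h (- g + x) = D (g + h) x - D g x" for h
        by (simp add: D_def minus_add add.assoc)
      have "apply_bcontfun (left_translate g (\<phi> h k)) x = D h (- g + x) \<bullet> D k (- g + x)"
        by (simp add: \<phi>)
      also have "\<dots> = (D (g + h) x - D g x) \<bullet> (D (g + k) x - D g x)" by (simp only: D)
      finally show "apply_bcontfun (left_translate g (\<phi> h k)) x
          = apply_bcontfun (\<phi> (g + h) (g + k) - \<phi> (g + h) g - \<phi> g (g + k) + \<phi> g g) x"
        by (simp add: \<phi> inner_diff_left inner_diff_right)
    qed
    from arg_cong[OF this, of m] show ?thesis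
      by (simp add: m_inv K_def linear_diff[OF m_linear] linear_add[OF m_linear])
  qed
  have upper: "K g g \<le> r\<^sup>2" if "\<And>x. norm (F (x + g) - F x) \<le> r" for g r
  proof -
    have "apply_bcontfun (\<phi> g g) x \<le> apply_bcontfun (const_bcontfun (r\<^sup>2)) x" for x
      using that[of "- x"] by (simp add: \<phi> D_def power_mono const_bcontfun.rep_eq flip: power2_norm_eq_inner)
    then show ?thesis unfolding K_def using m_mono m_const by metis
  qed
  have lower: "r\<^sup>2 \<le> K g g" if "0 \<le> r" "\<And>x. r \<le> norm (F (x + g) - F x)" for g r
  proof -
    have "apply_bcontfun (const_bcontfun (r\<^sup>2)) x \<le> apply_bcontfun (\<phi> g g) x" for x
      using that(1) that(2)[of "- x"]
      by (simp add: \<phi> D_def power_mono const_bcontfun.rep_eq flip: power2_norm_eq_inner)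
    then show ?thesis unfolding K_def using m_mono m_const by metis
  qed
  have K_lim: "((\<lambda>g. K g g) \<longlongrightarrow> 0) (nhds 0)"
  proof (rule tendstoI)
    fix e :: real assume "e > 0"
    then have "\<forall>\<^sub>F g in nhds 0. \<forall>x. norm (F (x + g) - F x) \<le> sqrt (e / 2)"
      using uc unfolding left_uniformly_continuous_def by simp
    then show "\<forall>\<^sub>F g in nhds 0. dist (K g g) 0 < e"
    proof eventually_elim
      case (elim g)
      then have "K g g \<le> (sqrt (e / 2))\<^sup>2" by (intro upper) auto
      moreover have "0 \<le> K g g" using lower[of 0 g] by simp
      ultimately show ?case using \<open>e > 0\<close> by simp
    qed
  qed
  obtain \<pi> and b :: "'g \<Rightarrow> 'g ell2"
    where \<pi>: "one_cocycle \<pi> b" and nb: "\<And>g. (norm (b g))\<^sup>2 = K g g"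
    by (rule cocycle_of_invariant_kernel[OF psd K_inv K_lim]) blast
  show thesis
  proof (rule that[OF \<pi>])
    fix g r assume "0 \<le> r" "\<And>x. r \<le> norm (F (x + g) - F x)"
    then show "r \<le> norm (b g)" using lower nb by (metis norm_ge_zero power2_le_imp_le)
  next
    fix g r assume *: "\<And>x. norm (F (x + g) - F x) \<le> r"
    then have "0 \<le> r" using order_trans[OF norm_ge_zero] by blast
    then show "norm (b g) \<le> r" using upper[OF *] nb by (metis power2_le_imp_le)
  qed
qed

section \<open>Compression and dilation\<close>

lemma one_cocycle_norm_diff:
  assumes "one_cocycle \<pi> b"
  shows "norm (b g - b h) = norm (b (- g + h))"
proof -
  have "b h = \<pi> g (b (- g + h)) + b g"
    using assms unfolding one_cocycle_def by (metis add.assoc add.right_inverse add_0)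
  moreover have "norm (\<pi> g (b (- g + h))) = norm (b (- g + h))"
    using assms unfolding one_cocycle_def orthogonal_representation_def orthogonal_transformation by blast
  ultimately show ?thesis by (metis add_diff_cancel_right' norm_minus_commute)
qed

lemma word_length_0 [simp]: "word_length S 0 = 0"
  unfolding word_length_def by (rule Least_eq_0) (auto intro!: exI[of _ "[]"])

lemma uniform_map_bounded:
  assumes "uniform_map S f"
  obtains B where "B \<ge> 0" "\<And>g h. word_length S (- g + h) \<le> n \<Longrightarrow> norm (f g - f h) \<le> B"
proof -
  have "dilation S f (real n) < \<infinity>" using assms unfolding uniform_map_def by simp
  moreover have le: "ereal (norm (f g - f h)) \<le> dilation S f (real n)"
    if "word_length S (- g + h) \<le> n" for g h
    unfolding dilation_def using that by (intro Sup_upper) auto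
  moreover have "0 \<le> dilation S f (real n)" using le[of 0 0] by (simp add: zero_ereal_def)
  ultimately obtain B where "dilation S f (real n) = ereal B" by (cases "dilation S f (real n)") auto
  then show thesis using that[of B] le \<open>0 \<le> dilation S f (real n)\<close> by simp
qed

text \<open>
  The points \<open>x\<close> and \<open>x + g\<close> are at word distance \<open>word_length S g\<close> for all \<open>x\<close>. So the compression
  and the dilation of \<open>f\<close> bound the increments of \<open>f\<close> uniformly in \<open>x\<close>, and those of \<open>F\<close> up to
  \<open>2 * c\<close>: the error is at most \<open>c\<close> at each of the two end points.
\<close>

lemma cocycle_near_uniform_map:
  fixes F :: "'g::topological_group_add \<Rightarrow> 'h::real_inner"
  assumes am: "amenable TYPE('g)" and uc: "left_uniformly_continuous F"
    and f: "uniform_map S f" and near: "\<And>x. norm (F x - f x) \<le> c"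
  obtains \<pi> :: "'g \<Rightarrow> 'g ell2 \<Rightarrow> 'g ell2" and b
  where "one_cocycle \<pi> b"
    "\<And>x. 0 \<le> x \<Longrightarrow> compression S f x - ereal (2 * c) \<le> compression S b x"
    "\<And>x. 0 \<le> x \<Longrightarrow> dilation S b x \<le> dilation S f x + ereal (2 * c)"
proof -
  have upper: "norm (F (x + g) - F x) \<le> norm (f x - f (x + g)) + 2 * c" for x g
  proof -
    have "norm (F (x + g) - F x) = norm ((f (x + g) - f x) + (F (x + g) - f (x + g)) - (F x - f x))"
      by simp
    then show ?thesis
      using norm_triangle_ineq4[of "(f (x + g) - f x) + (F (x + g) - f (x + g))" "F x - f x"]
        norm_triangle_ineq[of "f (x + g) - f x" "F (x + g) - f (x + g)"]
        near[of x] near[of "x + g"] norm_minus_commute[of "f x" "f (x + g)"] by linarith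
  qed
  have lower: "norm (f x - f (x + g)) - 2 * c \<le> norm (F (x + g) - F x)" for x g
  proof -
    have "norm (f x - f (x + g)) = norm ((F x - F (x + g)) + (F (x + g) - f (x + g)) - (F x - f x))"
      by simp
    then show ?thesis
      using norm_triangle_ineq4[of "(F x - F (x + g)) + (F (x + g) - f (x + g))" "F x - f x"]
        norm_triangle_ineq[of "F x - F (x + g)" "F (x + g) - f (x + g)"]
        near[of x] near[of "x + g"] norm_minus_commute[of "F x" "F (x + g)"] by linarith
  qed
  have "\<exists>B. \<forall>x. norm (F (x + g) - F x) \<le> B" for g
  proof -
    obtain B where B: "\<And>x y. word_length S (- x + y) \<le> word_length S g \<Longrightarrow> norm (f x - f y) \<le> B"
      using uniform_map_bounded[OF f, of "word_length S g"] by metis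
    have "norm (f x - f (x + g)) \<le> B" for x by (rule B) (simp flip: add.assoc)
    then have "norm (F (x + g) - F x) \<le> B + 2 * c" for x using upper[of x g] by (meson add_right_mono order_trans)
    then show ?thesis by blast
  qed
  then obtain \<pi> and b :: "'g \<Rightarrow> 'g ell2" where \<pi>: "one_cocycle \<pi> b"
    and ge: "\<And>g r. 0 \<le> r \<Longrightarrow> (\<And>x. r \<le> norm (F (x + g) - F x)) \<Longrightarrow> r \<le> norm (b g)"
    and le: "\<And>g r. (\<And>x. norm (F (x + g) - F x) \<le> r) \<Longrightarrow> norm (b g) \<le> r"
    using cocycle_of_amenable_average[OF am uc] by metis
  show thesis
  proof (rule that[OF \<pi>])
    fix x :: real assume "0 \<le> x"
    let ?c = "compression S f x"
    show "?c - ereal (2 * c) \<le> compression S b x"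
      unfolding compression_def[of S b]
    proof (rule Inf_greatest, clarify)
      fix g h assume x: "x \<le> real (word_length S (- g + h))"
      let ?k = "- g + h"
      have "?c \<le> ereal (norm (f y - f (y + k)))" if "x \<le> real (word_length S k)" for y k
        unfolding compression_def using that
        by (intro Inf_lower CollectI exI[of _ y] exI[of _ "y + k"]) (simp flip: add.assoc)
      from this[OF x] have c_le: "?c \<le> ereal (norm (f y - f (y + ?k)))" for y .
      have "0 \<le> ?c" unfolding compression_def by (rule Inf_greatest) auto
      then obtain r where r: "?c = ereal r" using c_le[of 0] by (cases ?c) auto
      have "r - 2 * c \<le> norm (b ?k)"
      proof (cases "0 \<le> r - 2 * c")
        case True
        have "r - 2 * c \<le> norm (F (y + ?k) - F y)" for y
          using lower[of y ?k] c_le[of y] r by simp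
        then show ?thesis using ge[OF True] by blast
      qed (use norm_ge_zero[of "b ?k"] in linarith)
      then show "?c - ereal (2 * c) \<le> ereal (norm (b g - b h))"
        by (simp add: r one_cocycle_norm_diff[OF \<pi>])
    qed
  next
    fix x :: real assume x0: "0 \<le> x"
    let ?d = "dilation S f x"
    have "?d < \<infinity>" using f x0 unfolding uniform_map_def by blast
    have d_ge: "ereal (norm (f y - f (y + k))) \<le> ?d" if "real (word_length S k) \<le> x" for y k
      unfolding dilation_def using that
      by (intro Sup_upper CollectI exI[of _ y] exI[of _ "y + k"]) (simp flip: add.assoc)
    have "0 \<le> ?d" using d_ge[of 0 0] x0 by (simp add: zero_ereal_def)
    with \<open>?d < \<infinity>\<close> obtain r where r: "?d = ereal r" by (cases ?d) auto
    show "dilation S b x \<le> ?d + ereal (2 * c)"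
      unfolding dilation_def[of S b]
    proof (rule Sup_least, clarify)
      fix g h assume x: "real (word_length S (- g + h)) \<le> x"
      have "norm (F (y + (- g + h)) - F y) \<le> r + 2 * c" for y
        using upper[of y "- g + h"] d_ge[OF x, of y] r by simp
      then have "norm (b (- g + h)) \<le> r + 2 * c" by (rule le)
      then show "ereal (norm (b g - b h)) \<le> ?d + ereal (2 * c)"
        by (simp add: r one_cocycle_norm_diff[OF \<pi>])
    qed
  qed
qed

section \<open>Word length on a locally compact group\<close>

lemma word_length_le_iff:
  assumes "generates_group S"
  shows "word_length S g \<le> n \<longleftrightarrow>
    (\<exists>w. length w \<le> n \<and> set w \<subseteq> S \<union> uminus ` S \<and> sum_list w = g)"
proof
  assume le: "word_length S g \<le> n"
  obtain w0 where "set w0 \<subseteq> S \<union> uminus ` S" "sum_list w0 = g"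
    using assms unfolding generates_group_def by blast
  then have "\<exists>w. length w = word_length S g \<and> set w \<subseteq> S \<union> uminus ` S \<and> sum_list w = g"
    unfolding word_length_def by (intro LeastI_ex[where P = "\<lambda>n. \<exists>w. length w = n \<and> _ w"]) blast
  then show "\<exists>w. length w \<le> n \<and> set w \<subseteq> S \<union> uminus ` S \<and> sum_list w = g" using le by metis
next
  assume "\<exists>w. length w \<le> n \<and> set w \<subseteq> S \<union> uminus ` S \<and> sum_list w = g"
  then obtain w where w: "length w \<le> n" "set w \<subseteq> S \<union> uminus ` S" "sum_list w = g" by blast
  then have "word_length S g \<le> length w" unfolding word_length_def by (intro Least_le) blast
  then show "word_length S g \<le> n" using w(1) by simp
qed

lemma word_length_add:
  assumes "generates_group S"
  shows "word_length S (g + h) \<le> word_length S g + word_length S h"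
proof -
  obtain v w where "length v \<le> word_length S g" "set v \<subseteq> S \<union> uminus ` S" "sum_list v = g"
    and "length w \<le> word_length S h" "set w \<subseteq> S \<union> uminus ` S" "sum_list w = h"
    using word_length_le_iff[OF assms] by (metis order_refl)
  then show ?thesis
    unfolding word_length_le_iff[OF assms] by (intro exI[of _ "v @ w"]) auto
qed

lemma word_length_minus:
  assumes "generates_group S"
  shows "word_length S (- g) = word_length S g"
proof -
  have "word_length S (- g) \<le> word_length S g" for g
  proof -
    obtain w where w: "length w \<le> word_length S g" "set w \<subseteq> S \<union> uminus ` S" "sum_list w = g"
      using word_length_le_iff[OF assms] by (metis order_refl)
    have "sum_list (map uminus (rev w)) = - sum_list w" for w :: "'a list"
      by (induction w) (auto simp: minus_add)
    moreover have "set (map uminus (rev w)) \<subseteq> S \<union> uminus ` S" using w(2) by force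
    ultimately show ?thesis
      unfolding word_length_le_iff[OF assms] using w by (intro exI[of _ "map uminus (rev w)"]) auto
  qed
  from this[of g] this[of "- g"] show ?thesis by simp
qed

lemma compact_word_ball:
  fixes S :: "'g::topological_group_add set"
  assumes gen: "generates_group S" and S: "compact S"
  shows "compact {g. word_length S g \<le> n}"
proof (induction n)
  case 0
  have "{g. word_length S g \<le> 0} = {0}" unfolding word_length_le_iff[OF gen] by auto
  then show ?case by simp
next
  case (Suc n)
  let ?A = "S \<union> uminus ` S"
  have "continuous_on S uminus" unfolding continuous_on_def by (auto intro: tendsto_intros)
  then have "compact ?A" using S by (intro compact_Un compact_continuous_image)
  then have "compact ((\<lambda>(s, g). s + g) ` (?A \<times> {g. word_length S g \<le> n}))"
    unfolding case_prod_unfold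
    by (intro compact_continuous_image compact_Times Suc continuous_intros)
  moreover have "{g. word_length S g \<le> Suc n}
      = insert 0 ((\<lambda>(s, g). s + g) ` (?A \<times> {g. word_length S g \<le> n}))"
  proof (intro equalityI subsetI)
    fix g assume "g \<in> {g. word_length S g \<le> Suc n}"
    then obtain w where w: "length w \<le> Suc n" "set w \<subseteq> ?A" "sum_list w = g"
      unfolding word_length_le_iff[OF gen] by blast
    then show "g \<in> insert 0 ((\<lambda>(s, g). s + g) ` (?A \<times> {g. word_length S g \<le> n}))"
      unfolding word_length_le_iff[OF gen] by (cases w) force+
  next
    fix g assume "g \<in> insert 0 ((\<lambda>(s, g). s + g) ` (?A \<times> {g. word_length S g \<le> n}))"
    then consider "g = 0" | s h where "s \<in> ?A" "word_length S h \<le> n" "g = s + h"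
      by auto
    then show "g \<in> {g. word_length S g \<le> Suc n}"
    proof cases
      case 2
      obtain w where "length w \<le> n" "set w \<subseteq> ?A" "sum_list w = h"
        using 2(2) unfolding word_length_le_iff[OF gen] by blast
      then show ?thesis
        unfolding word_length_le_iff[OF gen] using 2 by (intro CollectI exI[of _ "s # w"]) auto
    qed simp
  qed
  ultimately show ?case by simp
qed

text \<open>
  The group is the countable union of its compact word balls, so one of them has an interior point by
  Baire's theorem. Moving this point to \<open>0\<close> at most doubles the radius.
\<close>

lemma word_ball_neighbourhood:
  fixes S :: "'g::{topological_group_add, t2_space} set"
  assumes lc: "locally_compact_space (euclidean :: 'g topology)"
    and gen: "generates_group S" and S: "compact S"
  obtains p U where "open U" "0 \<in> U" "U \<subseteq> {g. word_length S g \<le> p}"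
proof -
  let ?B = "\<lambda>n. {g. word_length S g \<le> n}"
  have "\<exists>n. interior (?B n) \<noteq> {}"
  proof (rule ccontr)
    assume "\<not> ?thesis"
    then have none: "interior (?B n) = {}" for n by blast
    have "Hausdorff_space (euclidean :: 'g topology)"
      by (simp add: Hausdorff_space_def disjnt_def) (meson hausdorff)
    then have "regular_space (euclidean :: 'g topology)"
      using lc locally_compact_Hausdorff_imp_regular_space by blast
    moreover have "closed (?B n)" for n
      using compact_word_ball[OF gen S] by (rule compact_imp_closed)
    ultimately have "(euclidean :: 'g topology) interior_of \<Union> (range ?B) = {}"
      using lc none by (intro Baire_category_alt) auto
    moreover have "\<Union> (range ?B) = UNIV" by auto
    ultimately show False by simp
  qed
  then obtain n a where a: "a \<in> interior (?B n)" by blast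
  show thesis
  proof
    show "open ((\<lambda>g. a + g) -` interior (?B n))"
      by (intro open_vimage) (auto intro!: continuous_intros)
    show "0 \<in> (\<lambda>g. a + g) -` interior (?B n)" using a by simp
    show "(\<lambda>g. a + g) -` interior (?B n) \<subseteq> ?B (n + n)"
    proof clarify
      fix g assume "a + g \<in> interior (?B n)"
      then have "word_length S (a + g) \<le> n" "word_length S a \<le> n" using a interior_subset by blast+
      then show "word_length S g \<le> n + n"
        using word_length_add[OF gen, of "- a" "a + g"] by (simp add: word_length_minus[OF gen] flip: add.assoc)
    qed
  qed
qed

section \<open>Approximation by a uniformly continuous map\<close>

text \<open>
  If \<open>V - V \<subseteq> U\<close>, then each right translate of \<open>V\<close> contains at most one point of a set whose distinct
  points differ by elements outside \<open>U\<close>; finitely many translates cover \<open>C\<close>.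
\<close>

lemma card_separated_le:
  fixes C :: "'g::topological_group_add set"
  assumes C: "compact C" and U: "open U" "0 \<in> U"
  obtains N where "\<And>Z. Z \<subseteq> C \<Longrightarrow> \<forall>x\<in>Z. \<forall>y\<in>Z. x \<noteq> y \<longrightarrow> x - y \<notin> U \<Longrightarrow>
    finite Z \<and> card Z \<le> N"
proof -
  have "open ((\<lambda>z::'g \<times> 'g. fst z - snd z) -` U)"
  by (intro open_vimage U continuous_intros)
  moreover have "(0, 0) \<in> (\<lambda>z::'g \<times> 'g. fst z - snd z) -` U" using U by simp
  ultimately obtain A B where AB: "open A" "open B" "(0, 0) \<in> A \<times> B"
    "A \<times> B \<subseteq> (\<lambda>z::'g \<times> 'g. fst z - snd z) -` U"
    by (rule open_prod_elim)
  define V where "V = A \<inter> B"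
  have V: "open V" "0 \<in> V" using AB by (auto simp: V_def)
  have V_diff: "v - w \<in> U" if "v \<in> V" "w \<in> V" for v w
    using AB(4) that by (auto simp: V_def)
  have "open ((\<lambda>x. x + - c) -` V)" for c
    by (intro open_vimage V continuous_intros)
  moreover have "C \<subseteq> (\<Union>c\<in>C. (\<lambda>x. x + - c) -` V)" using V by auto
  ultimately obtain D where D: "D \<subseteq> C" "finite D" "C \<subseteq> (\<Union>c\<in>D. (\<lambda>x. x + - c) -` V)"
    using compactE_image[OF C, of C "\<lambda>c. (\<lambda>x. x + - c) -` V"] by blast
  show thesis
  proof
    fix Z assume Z: "Z \<subseteq> C" and sep: "\<forall>x\<in>Z. \<forall>y\<in>Z. x \<noteq> y \<longrightarrow> x - y \<notin> U"
    have "\<forall>x\<in>Z. \<exists>c\<in>D. x + - c \<in> V" using D(3) Z by blast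
    then obtain \<kappa> where \<kappa>: "\<And>x. x \<in> Z \<Longrightarrow> \<kappa> x \<in> D \<and> x + - \<kappa> x \<in> V" by metis
    have "inj_on \<kappa> Z"
    proof (rule inj_onI, rule ccontr)
      fix x y assume xy: "x \<in> Z" "y \<in> Z" "\<kappa> x = \<kappa> y" "x \<noteq> y"
      have "(x + - \<kappa> x) - (y + - \<kappa> x) \<in> U" using \<kappa>[OF xy(1)] \<kappa>[OF xy(2)] xy(3) V_diff by metis
      then have "x - y \<in> U" by (simp add: diff_conv_add_uminus minus_add add.assoc del: add_uminus_conv_diff)
      then show False using sep xy by blast
    qed
    then show "finite Z \<and> card Z \<le> card D"
      using \<kappa> D(2) by (metis card_inj_on_le finite_imageD finite_subset image_subsetI)
  qed
qed

text \<open>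
  Compactness gives a uniform estimate for base points \<open>y\<close> in the support. If instead \<open>y + g\<close> is in the
  support, the same estimate applies at \<open>y + g\<close> to the translation by \<open>- g\<close>.
\<close>

lemma compact_support_left_uniformly_continuous:
  fixes \<theta> :: "'g::topological_group_add \<Rightarrow> real"
  assumes cont: "continuous_on UNIV \<theta>" and C: "compact C" and supp: "\<And>x. x \<notin> C \<Longrightarrow> \<theta> x = 0"
  shows "left_uniformly_continuous \<theta>"
  unfolding left_uniformly_continuous_def
proof (intro allI impI)
  fix e :: real assume e: "e > 0"
  have "continuous_on (UNIV \<times> C) (\<lambda>(g, y). \<theta> (y + g))"
    unfolding case_prod_unfold
    by (rule continuous_on_compose2[OF cont]) (auto intro!: continuous_intros)
  then obtain X where X: "0 \<in> X" "open X"
    and "\<forall>g\<in>X \<inter> UNIV. \<forall>y\<in>C. dist ((\<lambda>(g, y). \<theta> (y + g)) (g, y)) ((\<lambda>(g, y). \<theta> (y + g)) (0, y)) \<le> e"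
    by (rule continuous_on_prod_compactE[OF _ C UNIV_I e])
  then have X_C: "\<bar>\<theta> (y + g) - \<theta> y\<bar> \<le> e" if "g \<in> X" "y \<in> C" for g y
    using that by (simp add: dist_real_def)
  have "open (uminus -` X)"
    using X(2) by (intro open_vimage) (auto simp: continuous_on_def intro: tendsto_intros)
  then have "\<forall>\<^sub>F g in nhds 0. g \<in> X \<inter> uminus -` X"
    using X by (intro eventually_nhds_in_open) auto
  then show "\<forall>\<^sub>F g in nhds 0. \<forall>y. norm (\<theta> (y + g) - \<theta> y) \<le> e"
  proof (eventually_elim, intro allI)
    fix g y assume g: "g \<in> X \<inter> uminus -` X"
    consider "y \<in> C" | "y + g \<in> C" | "y \<notin> C" "y + g \<notin> C" by blast
    then show "norm (\<theta> (y + g) - \<theta> y) \<le> e"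
    proof cases
      case 2
      then have "\<bar>\<theta> (y + g + - g) - \<theta> (y + g)\<bar> \<le> e" using g by (intro X_C) auto
      then show ?thesis by simp
    qed (use X_C g supp e in auto)
  qed
qed

text \<open>
  A perturbation of the weights changes the numerator and the normalization, and each contributes one
  of the two terms \<open>B * (\<Sum>i\<in>A. \<bar>v i - u i\<bar>)\<close>. Total weights of at least \<open>1\<close> keep the denominators
  harmless.
\<close>

lemma weighted_mean_diff_le:
  fixes s :: "'i \<Rightarrow> 'h::real_normed_vector"
  assumes s: "\<And>i. i \<in> A \<Longrightarrow> norm (s i) \<le> B"
    and u: "\<And>i. i \<in> A \<Longrightarrow> 0 \<le> u i" "1 \<le> sum u A"
    and v: "\<And>i. i \<in> A \<Longrightarrow> 0 \<le> v i" "1 \<le> sum v A"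
  shows "norm ((\<Sum>i\<in>A. v i *\<^sub>R s i) /\<^sub>R sum v A - (\<Sum>i\<in>A. u i *\<^sub>R s i) /\<^sub>R sum u A)
    \<le> 2 * B * (\<Sum>i\<in>A. \<bar>v i - u i\<bar>)"
proof -
  let ?T = "sum u A" and ?T' = "sum v A" and ?D = "\<Sum>i\<in>A. \<bar>v i - u i\<bar>"
  have "A \<noteq> {}" using u(2) by auto
  then have B: "0 \<le> B" using s norm_ge_zero order_trans by blast
  have D: "0 \<le> ?D" by (intro sum_nonneg) auto
  have "norm (\<Sum>i\<in>A. (v i - u i) *\<^sub>R s i) \<le> (\<Sum>i\<in>A. \<bar>v i - u i\<bar> * B)"
    by (rule sum_norm_le) (auto intro!: mult_left_mono s)
  then have 1: "norm (\<Sum>i\<in>A. (v i - u i) *\<^sub>R s i) \<le> ?D * B" by (simp add: sum_distrib_right)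
  have "norm (\<Sum>i\<in>A. u i *\<^sub>R s i) \<le> (\<Sum>i\<in>A. u i * B)"
    by (rule sum_norm_le) (auto intro!: mult_left_mono s simp: u(1))
  then have 2: "norm (\<Sum>i\<in>A. u i *\<^sub>R s i) \<le> ?T * B" by (simp add: sum_distrib_right)
  have 3: "\<bar>?T - ?T'\<bar> \<le> ?D"
    by (simp add: sum_subtractf[symmetric] abs_minus_commute order_trans[OF sum_abs])
  have "(\<Sum>i\<in>A. v i *\<^sub>R s i) /\<^sub>R ?T' - (\<Sum>i\<in>A. u i *\<^sub>R s i) /\<^sub>R ?T
      = (\<Sum>i\<in>A. (v i - u i) *\<^sub>R s i) /\<^sub>R ?T' + ((?T - ?T') / (?T * ?T')) *\<^sub>R (\<Sum>i\<in>A. u i *\<^sub>R s i)"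
  proof -
    have "(?T - ?T') / (?T * ?T') = inverse ?T' - inverse ?T" using u(2) v(2) by (simp add: field_simps)
    then show ?thesis by (simp add: scaleR_diff_left scaleR_diff_right sum_subtractf)
  qed
  also have "norm \<dots> \<le> norm ((\<Sum>i\<in>A. (v i - u i) *\<^sub>R s i) /\<^sub>R ?T')
      + norm (((?T - ?T') / (?T * ?T')) *\<^sub>R (\<Sum>i\<in>A. u i *\<^sub>R s i))"
    by (rule norm_triangle_ineq)
  also have "norm ((\<Sum>i\<in>A. (v i - u i) *\<^sub>R s i) /\<^sub>R ?T') \<le> ?D * B"
  proof -
    have "norm ((\<Sum>i\<in>A. (v i - u i) *\<^sub>R s i) /\<^sub>R ?T') \<le> 1 * (?D * B)"
      unfolding norm_scaleR using v(2) 1 by (intro mult_mono) (auto simp: inverse_le_1_iff)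
    then show ?thesis by simp
  qed
  also have "norm (((?T - ?T') / (?T * ?T')) *\<^sub>R (\<Sum>i\<in>A. u i *\<^sub>R s i)) \<le> ?D * B"
  proof -
    have "norm (((?T - ?T') / (?T * ?T')) *\<^sub>R (\<Sum>i\<in>A. u i *\<^sub>R s i))
        \<le> \<bar>(?T - ?T') / (?T * ?T')\<bar> * (?T * B)"
      unfolding norm_scaleR by (intro mult_left_mono 2) auto
    also have "\<dots> = \<bar>?T - ?T'\<bar> * B / ?T'" using u(2) v(2) by (simp add: abs_mult)
    also have "\<dots> \<le> \<bar>?T - ?T'\<bar> * B / 1" using v(2) B by (intro divide_left_mono) auto
    also have "\<dots> \<le> ?D * B" using 3 B by (simp add: mult_right_mono)
    finally show ?thesis .
  qed
  finally show ?thesis by (simp add: algebra_simps)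
qed

text \<open>
  A maximal separated set is a net, since a point unrelated to all of its elements could be added to it.
\<close>

lemma maximal_separated_set:
  fixes P :: "'a \<Rightarrow> 'a \<Rightarrow> bool"
  assumes refl: "\<And>x. P x x" and sym: "\<And>x y. P x y \<Longrightarrow> P y x"
  obtains X where "\<And>x y. x \<in> X \<Longrightarrow> y \<in> X \<Longrightarrow> x \<noteq> y \<Longrightarrow> \<not> P x y" "\<And>y. \<exists>x\<in>X. P x y"
proof -
  define sep where "sep = {X. \<forall>x\<in>X. \<forall>y\<in>X. x \<noteq> y \<longrightarrow> \<not> P x y}"
  have "\<exists>M\<in>sep. \<forall>X\<in>sep. M \<subseteq> X \<longrightarrow> X = M"
  proof (rule subset_Zorn')
    fix C assume C: "subset.chain sep C"
    then have "C \<subseteq> sep" and ch: "\<And>X Y. X \<in> C \<Longrightarrow> Y \<in> C \<Longrightarrow> X \<subseteq> Y \<or> Y \<subseteq> X"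
      by (auto simp: subset_chain_def)
    show "\<Union>C \<in> sep"
      unfolding sep_def
    proof (clarify)
      fix x y X Y assume "x \<in> X" "X \<in> C" "y \<in> Y" "Y \<in> C" "x \<noteq> y" "P x y"
      moreover have "X \<in> sep" "Y \<in> sep" using \<open>C \<subseteq> sep\<close> calculation by blast+
      ultimately show False using ch[of X Y] unfolding sep_def by blast
    qed
  qed
  then obtain M where M: "M \<in> sep" and max: "\<And>X. X \<in> sep \<Longrightarrow> M \<subseteq> X \<Longrightarrow> X = M" by blast
  show thesis
  proof
    show "\<not> P x y" if "x \<in> M" "y \<in> M" "x \<noteq> y" for x y using M that by (auto simp: sep_def)
    show "\<exists>x\<in>M. P x y" for y
    proof (rule ccontr)
      assume no: "\<not> ?thesis"
      then have "insert y M \<in> sep" using M sym unfolding sep_def by blast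
      then have "y \<in> M" using max by blast
      then show False using no refl by blast
    qed
  qed
qed

text \<open>
  The map \<open>F y\<close> is a weighted mean of the values of \<open>f\<close> at the points of a net near \<open>y\<close>; the weights
  are translates of one continuous bump function \<open>\<theta>\<close> with compact support. The values of \<open>f\<close> that
  enter are at bounded word distance from \<open>y\<close>, so \<open>F\<close> is at bounded distance from \<open>f\<close>. At most
  \<open>N\<close> points of the net contribute, for a bound \<open>N\<close> that does not depend on \<open>y\<close>, and so the uniform
  continuity of \<open>\<theta>\<close> passes to \<open>F\<close>.
\<close>

lemma uniform_map_smoothing:
  fixes S :: "'g::{topological_group_add, t2_space} set"
    and f :: "'g \<Rightarrow> 'h::real_normed_vector"
  assumes lc: "locally_compact_space (euclidean :: 'g topology)"
    and S: "compact S" and gen: "generates_group S" and f: "uniform_map S f"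
  obtains F c where "0 \<le> c" "left_uniformly_continuous F" "\<And>x. norm (F x - f x) \<le> c"
proof -
  let ?l = "word_length S"
  note l_add = word_length_add[OF gen] and l_minus = word_length_minus[OF gen]
  have l_swap: "?l (- y + x) = ?l (- x + y)" for x y
  proof -
    have "- y + x = - (- x + y)" by (simp add: minus_add)
    then show ?thesis by (simp only: l_minus)
  qed
  obtain p U where U: "open U" "0 \<in> U" and U_p: "\<And>g. g \<in> U \<Longrightarrow> ?l g \<le> p"
    by (rule word_ball_neighbourhood[OF lc gen S]) blast
  \<comment> \<open>This radius makes the ball of radius \<open>p\<close> lie in the interior of \<open>C\<close>.\<close>
  define q where "q = p + p"
  define C where "C = {g. ?l g \<le> q}"
  have C: "compact C" unfolding C_def using gen S by (rule compact_word_ball)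
  have U_C: "{g. ?l g \<le> p} \<subseteq> interior C"
  proof
    fix a assume a: "a \<in> {g. ?l g \<le> p}"
    show "a \<in> interior C"
    proof (rule interiorI)
      show "open ((\<lambda>g. - a + g) -` U)" by (intro open_vimage U continuous_intros)
      show "a \<in> (\<lambda>g. - a + g) -` U" using U by simp
      show "(\<lambda>g. - a + g) -` U \<subseteq> C"
      proof clarify
        fix g assume "- a + g \<in> U"
        then have "?l (- a + g) \<le> p" by (rule U_p)
        then have "?l a + ?l (- a + g) \<le> p + p" using a by simp
        then have "?l (a + (- a + g)) \<le> p + p" using l_add order_trans by blast
        then show "g \<in> C" by (simp add: C_def q_def flip: add.assoc)
      qed
    qed
  qed
  have "completely_regular_space (euclidean :: 'g topology)"
    by (rule locally_compact_regular_imp_completely_regular_space[OF lc])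
      (simp add: Hausdorff_space_def disjnt_def, meson hausdorff)
  moreover have "compactin euclidean {g. ?l g \<le> p}"
    using compact_word_ball[OF gen S] by simp
  moreover have "closedin euclidean (- interior C)" by (simp add: closed_Compl)
  moreover have "disjnt {g. ?l g \<le> p} (- interior C)" using U_C by (auto simp: disjnt_def)
  ultimately obtain \<theta> where \<theta>: "continuous_map euclidean (top_of_set {0..1::real}) \<theta>"
    and \<theta>0: "\<theta> ` (- interior C) \<subseteq> {0}" and \<theta>1: "\<theta> ` {g. ?l g \<le> p} \<subseteq> {1}"
    using Urysohn_completely_regular_compact_closed[of 0 1 euclidean "{g. ?l g \<le> p}" "- interior C"]
    by (metis zero_le_one)
  have \<theta>_cont: "continuous_on UNIV \<theta>" and \<theta>_nonneg: "\<And>x. 0 \<le> \<theta> x"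
    using \<theta> by (auto simp: continuous_map_in_subtopology)
  have \<theta>_supp: "\<theta> x = 0" if "x \<notin> C" for x
    using \<theta>0 that interior_subset[of C] by blast
  have \<theta>_one: "\<theta> x = 1" if "?l x \<le> p" for x using \<theta>1 that by blast
  have \<theta>_uc: "left_uniformly_continuous \<theta>"
    using \<theta>_cont C \<theta>_supp by (rule compact_support_left_uniformly_continuous)
  obtain X where X_sep: "\<And>x y. x \<in> X \<Longrightarrow> y \<in> X \<Longrightarrow> x \<noteq> y \<Longrightarrow> \<not> ?l (- x + y) \<le> p"
    and X_max: "\<And>y. \<exists>x\<in>X. ?l (- x + y) \<le> p"
    by (rule maximal_separated_set[of "\<lambda>x y. ?l (- x + y) \<le> p"]) (use l_swap in auto)
  obtain N where N: "\<And>Z. Z \<subseteq> C \<Longrightarrow> \<forall>x\<in>Z. \<forall>y\<in>Z. x \<noteq> y \<longrightarrow> x - y \<notin> U \<Longrightarrow>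
    finite Z \<and> card Z \<le> N"
    by (rule card_separated_le[OF C U]) blast
  define E where "E y = {x \<in> X. - x + y \<in> C}" for y
  have E: "finite (E y)" "card (E y) \<le> N" for y
  proof -
    let ?Z = "(\<lambda>x. - x + y) ` E y"
    have inj: "inj_on (\<lambda>x. - x + y) (E y)" by (simp add: inj_on_def)
    have "finite ?Z \<and> card ?Z \<le> N"
    proof (intro N ballI impI)
      show "?Z \<subseteq> C" by (auto simp: E_def)
    next
      fix z z' assume "z \<in> ?Z" "z' \<in> ?Z" "z \<noteq> z'"
      then obtain x x' where x: "x \<in> X" "x' \<in> X" "x \<noteq> x'" "z = - x + y" "z' = - x' + y"
        by (auto simp: E_def)
      have "z - z' = - x + x'"
        unfolding x diff_conv_add_uminus minus_add minus_minus by (simp add: add.assoc)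
      then show "z - z' \<notin> U" using X_sep[OF x(1-3)] U_p by auto
    qed
    then show "finite (E y)" "card (E y) \<le> N"
      using inj by (auto simp: card_image dest: finite_imageD)
  qed
  define T where "T y = (\<Sum>x\<in>E y. \<theta> (- x + y))" for y
  define F where "F y = (\<Sum>x\<in>E y. \<theta> (- x + y) *\<^sub>R f x) /\<^sub>R T y" for y
  have T_ge: "1 \<le> T y" for y
  proof -
    obtain x where x: "x \<in> X" "?l (- x + y) \<le> p" using X_max by blast
    then have "\<theta> (- x + y) \<le> T y"
      unfolding T_def by (intro member_le_sum \<theta>_nonneg E) (auto simp: E_def C_def q_def)
    then show ?thesis using \<theta>_one[OF x(2)] by simp
  qed
  \<comment> \<open>The sums may be taken over any finite part of the net that contains \<open>E y\<close>. This allows the means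
    at two nearby points to be compared over a common index set.\<close>
  have extend: "T y = (\<Sum>x\<in>A. \<theta> (- x + y))"
    "F y - v = (\<Sum>x\<in>A. \<theta> (- x + y) *\<^sub>R (f x - v)) /\<^sub>R (\<Sum>x\<in>A. \<theta> (- x + y))"
    if A: "finite A" "E y \<subseteq> A" "A \<subseteq> X" for A y v
  proof -
    have out: "\<theta> (- x + y) = 0" if "x \<in> A - E y" for x
      using that A \<theta>_supp by (auto simp: E_def)
    show T: "T y = (\<Sum>x\<in>A. \<theta> (- x + y))"
      unfolding T_def using A out by (intro sum.mono_neutral_left) auto
    have "(\<Sum>x\<in>E y. \<theta> (- x + y) *\<^sub>R f x) = (\<Sum>x\<in>A. \<theta> (- x + y) *\<^sub>R f x)"
      using A out by (intro sum.mono_neutral_left) auto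
    then have "(\<Sum>x\<in>A. \<theta> (- x + y) *\<^sub>R (f x - v)) = T y *\<^sub>R F y - T y *\<^sub>R v"
      using T_ge[of y] by (simp add: scaleR_diff_right sum_subtractf F_def T scaleR_sum_left)
    then have "(\<Sum>x\<in>A. \<theta> (- x + y) *\<^sub>R (f x - v)) /\<^sub>R T y = F y - v"
      using T_ge[of y] by (simp add: scaleR_diff_right)
    then show "F y - v = (\<Sum>x\<in>A. \<theta> (- x + y) *\<^sub>R (f x - v)) /\<^sub>R (\<Sum>x\<in>A. \<theta> (- x + y))"
      by (simp add: T)
  qed
  \<comment> \<open>Points \<open>x\<close> with \<open>- x + y \<in> C\<close> are within distance \<open>q\<close> of \<open>y\<close>; the extra \<open>p\<close> is for a
    translation of \<open>y\<close> by an element of \<open>U\<close>.\<close>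
  obtain B where B: "0 \<le> B" and f_B: "\<And>x y. ?l (- x + y) \<le> q + p \<Longrightarrow> norm (f x - f y) \<le> B"
    using uniform_map_bounded[OF f] by metis
  have "norm (F y - f y) \<le> B" for y
  proof -
    have "norm (\<Sum>x\<in>E y. \<theta> (- x + y) *\<^sub>R (f x - f y)) \<le> (\<Sum>x\<in>E y. \<theta> (- x + y) * B)"
    proof (rule sum_norm_le)
      fix x assume "x \<in> E y"
      then have "norm (f x - f y) \<le> B" by (intro f_B) (auto simp: E_def C_def)
      then show "norm (\<theta> (- x + y) *\<^sub>R (f x - f y)) \<le> \<theta> (- x + y) * B"
        by (simp add: \<theta>_nonneg mult_left_mono)
    qed
    also have "\<dots> = T y * B" by (simp add: T_def sum_distrib_right)
    finally have le: "norm (\<Sum>x\<in>E y. \<theta> (- x + y) *\<^sub>R (f x - f y)) \<le> T y * B" .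
    have "F y - f y = (\<Sum>x\<in>E y. \<theta> (- x + y) *\<^sub>R (f x - f y)) /\<^sub>R T y"
      using extend(2)[of "E y" y "f y"] E by (simp add: T_def E_def)
    then have "norm (F y - f y) = norm (\<Sum>x\<in>E y. \<theta> (- x + y) *\<^sub>R (f x - f y)) / T y"
      using T_ge[of y] by (simp add: divide_inverse)
    also have "\<dots> \<le> B" using le T_ge[of y] by (simp add: divide_le_eq mult.commute)
    finally show ?thesis .
  qed
  moreover have "left_uniformly_continuous F"
    unfolding left_uniformly_continuous_def
  proof (intro allI impI)
    fix e :: real assume e: "e > 0"
    \<comment> \<open>At most \<open>2 * N\<close> points enter the comparison, and weights are compared with the factor \<open>2 * B\<close>;
      the summand \<open>1\<close> keeps \<open>M\<close> positive.\<close>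
    define M where "M = 4 * B * real N + 1"
    have M: "M > 0" using B by (simp add: M_def add_nonneg_pos)
    have "\<forall>\<^sub>F g in nhds 0. \<forall>x. norm (\<theta> (x + g) - \<theta> x) \<le> e / M"
      using \<theta>_uc e M unfolding left_uniformly_continuous_def by (meson divide_pos_pos)
    moreover have "\<forall>\<^sub>F g in nhds 0. g \<in> U" using U by (rule eventually_nhds_in_open)
    ultimately show "\<forall>\<^sub>F g in nhds 0. \<forall>y. norm (F (y + g) - F y) \<le> e"
    proof (eventually_elim, intro allI)
      fix g y assume \<theta>_g: "\<forall>x. norm (\<theta> (x + g) - \<theta> x) \<le> e / M" and g: "g \<in> U"
      define A where "A = E y \<union> E (y + g)"
      have A: "finite A" "E y \<subseteq> A" "E (y + g) \<subseteq> A" "A \<subseteq> X"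
        using E by (auto simp: A_def E_def)
      have card_A: "card A \<le> 2 * N"
        unfolding A_def using card_Un_le[of "E y" "E (y + g)"] E(2)[of y] E(2)[of "y + g"] by linarith
      let ?u = "\<lambda>x. \<theta> (- x + y)" and ?v = "\<lambda>x. \<theta> (- x + (y + g))"
      have f_A: "norm (f x - f y) \<le> B" if "x \<in> A" for x
      proof (rule f_B)
        consider "- x + y \<in> C" | "- x + (y + g) \<in> C" using \<open>x \<in> A\<close> by (auto simp: A_def E_def)
        then show "?l (- x + y) \<le> q + p"
        proof cases
          case 2
          have "- x + y = (- x + (y + g)) + - g" by (simp only: add.assoc) simp
          then have "?l (- x + y) \<le> ?l (- x + (y + g)) + ?l (- g)" using l_add by metis
          also have "\<dots> \<le> q + p" using 2 U_p[OF g] by (intro add_mono) (auto simp: C_def l_minus)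
          finally show ?thesis .
        qed (simp add: C_def)
      qed
      have "F (y + g) - F y = (F (y + g) - f y) - (F y - f y)" by simp
      also have "\<dots> = (\<Sum>x\<in>A. ?v x *\<^sub>R (f x - f y)) /\<^sub>R sum ?v A
          - (\<Sum>x\<in>A. ?u x *\<^sub>R (f x - f y)) /\<^sub>R sum ?u A"
        by (simp only: extend(2)[OF A(1,3,4)] extend(2)[OF A(1,2,4)])
      finally have "norm (F (y + g) - F y) = norm ((\<Sum>x\<in>A. ?v x *\<^sub>R (f x - f y)) /\<^sub>R sum ?v A
          - (\<Sum>x\<in>A. ?u x *\<^sub>R (f x - f y)) /\<^sub>R sum ?u A)" by (rule arg_cong)
      also have "\<dots> \<le> 2 * B * (\<Sum>x\<in>A. \<bar>?v x - ?u x\<bar>)"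
      proof (rule weighted_mean_diff_le)
        show "1 \<le> sum ?u A" "1 \<le> sum ?v A"
          using T_ge[of y] T_ge[of "y + g"] by (simp_all only: extend(1)[OF A(1,2,4)] extend(1)[OF A(1,3,4)])
      qed (auto intro: f_A \<theta>_nonneg)
      also have "\<dots> \<le> 2 * B * (\<Sum>x\<in>A. e / M)"
      proof (intro mult_left_mono sum_mono)
        show "\<bar>?v x - ?u x\<bar> \<le> e / M" for x
          using \<theta>_g[rule_format, of "- x + y"] by (simp add: add.assoc)
      qed (use B in auto)
      also have "\<dots> = 2 * B * (e / M) * real (card A)" by simp
      also have "\<dots> \<le> 2 * B * (e / M) * real (2 * N)"
        using B e M card_A by (intro mult_left_mono) auto
      also have "\<dots> = (e / M) * (M - 1)" by (simp add: M_def algebra_simps)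
      also have "\<dots> \<le> e" using e M by (simp add: field_simps)
      finally show "norm (F (y + g) - F y) \<le> e" .
    qed
  qed
  ultimately show thesis using that B by blast
qed

lemma discrete_left_uniformly_continuous:
  fixes f :: "'g::topological_group_add \<Rightarrow> 'h::real_normed_vector"
  assumes "discrete (UNIV :: 'g set)"
  shows "left_uniformly_continuous f"
proof -
  have "open {0 :: 'g}"
    using assms unfolding discrete_def isolated_in_def by force
  then have "\<forall>\<^sub>F g in nhds (0::'g). g \<in> {0}" by (rule eventually_nhds_in_open) simp
  then show ?thesis
    unfolding left_uniformly_continuous_def by (auto elim!: eventually_mono)
qed

section \<open>Cocycles from uniform maps\<close>

theorem proposition4p4:
  fixes S :: "'g::{topological_group_add, t2_space} set"
    and f :: "'g \<Rightarrow> 'h::{real_inner, complete_space}"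
  assumes "locally_compact_space (euclidean :: 'g topology)"
    and "compact S" and "symmetric_set S" and "generates_group S"
    and "amenable TYPE('g)"
    and "uniform_map S f"
  shows "(\<exists>a\<ge>0. \<exists>(\<pi> :: 'g \<Rightarrow> 'g ell2 \<Rightarrow> 'g ell2) b. one_cocycle \<pi> b \<and>
            (\<forall>x\<ge>0. compression S b x \<ge> compression S f x - ereal a \<and>
                    dilation S b x \<le> dilation S f x + ereal a)) \<and>
         (discrete (UNIV :: 'g set) \<longrightarrow>
           (\<exists>(\<pi> :: 'g \<Rightarrow> 'g ell2 \<Rightarrow> 'g ell2) b. one_cocycle \<pi> b \<and>
            (\<forall>x\<ge>0. compression S b x \<ge> compression S f x \<and>
                    dilation S b x \<le> dilation S f x)))"
proof (intro conjI impI)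
  obtain F c where c: "0 \<le> c" and F: "left_uniformly_continuous F" "\<And>x. norm (F x - f x) \<le> c"
    by (rule uniform_map_smoothing[OF assms(1,2,4,6)]) blast
  show "\<exists>a\<ge>0. \<exists>(\<pi> :: 'g \<Rightarrow> 'g ell2 \<Rightarrow> 'g ell2) b. one_cocycle \<pi> b \<and>
      (\<forall>x\<ge>0. compression S b x \<ge> compression S f x - ereal a \<and>
              dilation S b x \<le> dilation S f x + ereal a)"
    by (rule cocycle_near_uniform_map[OF assms(5) F(1) assms(6) F(2)])
      (use c in \<open>intro exI[of _ "2 * c"], auto\<close>)
next
  assume "discrete (UNIV :: 'g set)"
  then have uc: "left_uniformly_continuous f" by (rule discrete_left_uniformly_continuous)
  have near: "norm (f x - f x) \<le> 0" for x by simp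
  obtain \<pi> and b :: "'g \<Rightarrow> 'g ell2" where "one_cocycle \<pi> b"
    "\<And>x. 0 \<le> x \<Longrightarrow> compression S f x - ereal (2 * 0) \<le> compression S b x"
    "\<And>x. 0 \<le> x \<Longrightarrow> dilation S b x \<le> dilation S f x + ereal (2 * 0)"
    by (rule cocycle_near_uniform_map[OF assms(5) uc assms(6) near]) blast
  then show "\<exists>(\<pi> :: 'g \<Rightarrow> 'g ell2 \<Rightarrow> 'g ell2) b. one_cocycle \<pi> b \<and>
      (\<forall>x\<ge>0. compression S b x \<ge> compression S f x \<and> dilation S b x \<le> dilation S f x)"
    by (intro exI[of _ \<pi>] exI[of _ b]) (simp flip: zero_ereal_def)
qed

end
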